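(* Let $f$, $g$, $A\in\mathbb{R}^{p\times m}$, $B\in\mathbb{R}^{p\times n}$, $b\in\mathbb{R}^p$ satisfy either the "smooth case" assumption or the "strongly convex case" assumption (both defined in the context). Consider the iterates generated by Algorithm 2 (defined in the context) with tolerance $\varepsilon>0$. Then the following hold. (i) At every iteration the number of backtrackings (executions of step (8)) is finite, regardless of whether $i_{\max}$ is finite or not. (ii) The algorithm terminates in $K\le\frac{\beta}{c\varepsilon^2}\,\bigl|\mathscr L_\beta(x^0,z^0,y^0)-\min\Phi\bigr|$ iterations and yields a triplet $(x,y,z):=(x^K,y^K,z^K)$ satisfying the approximate KKT conditions $$\|Ax+Bz-b\|\le\varepsilon/\beta,\qquad -A^\top y\in\hat\partial f(x),\qquad \operatorname{dist}\bigl(-B^\top y,\hat\partial g(z)\bigr)\le\|B\|\,\varepsilon .$$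
   Context: The problem is: minimize $f(x)+g(z)$ over $(x,z)\in\mathbb{R}^m\times\mathbb{R}^n$ subject to $Ax+Bz=b$. Set $\Phi(x,z)=f(x)+g(z)$ if $Ax+Bz=b$ and $\Phi(x,z)=\infty$ otherwise; $\min\Phi$ denotes the optimal value of the problem. For a function $h$ on $\mathbb{R}^n$ and a matrix $C\in\mathbb{R}^{p\times n}$, the epicomposition is $(Ch):\mathbb{R}^p\to[-\infty,\infty]$, $(Ch)(s)=\inf\{h(x): Cx=s\}$. Smooth case assumption: $f:\mathbb{R}^m\to\mathbb{R}$, $g:\mathbb{R}^n\to\mathbb{R}\cup\{\infty\}$; $A$ has full row rank and $(Af):\mathbb{R}^p\to\mathbb{R}$ is differentiable with $L_{(Af)}$-Lipschitz continuous gradient; $(Bg):\mathbb{R}^p\to\mathbb{R}\cup\{\infty\}$ is lower semicontinuous (lsc); $\operatorname{argmin}\Phi\ne\emptyset$. Strongly convex case assumption: $f:\mathbb{R}^m\to\mathbb{R}\cup\{\infty\}$ is lsc, proper and $\mu_f$-strongly convex; $g:\mathbb{R}^n\to\mathbb{R}\cup\{\infty\}$ is such that $(Bg):\mathbb{R}^p\to\mathbb{R}\cup\{\infty\}$ is lsc, proper and convex; $b\in\operatorname{relint}(A\operatorname{dom}f+B\operatorname{dom}g)$. Notation: $\hat\partial h$ is the regular (Fréchet) subdifferential, i.e. $v\in\hat\partial h(\bar x)$ iff $\liminf_{\bar x\ne x\to\bar x}\frac{h(x)-h(\bar x)-\langle v,x-\bar x\rangle}{\|x-\bar x\|}\ge0$.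 $\operatorname{dist}(x,E)=\inf_{w\in E}\|w-x\|$. Augmented Lagrangian: $\mathscr L_\beta(x,z,y)=f(x)+g(z)+\langle y,Ax+Bz-b\rangle+\frac\beta2\|Ax+Bz-b\|^2$. ADMM oracle: $\mathrm{ADMM}_\beta(\tilde y,\tilde z)$ is the set of $(x,y,z)$ with $x\in\operatorname{argmin}\mathscr L_\beta(\cdot,\tilde z,\tilde y)$, $y=\tilde y+\beta(Ax+B\tilde z-b)$, $z\in\operatorname{argmin}\mathscr L_\beta(x,\cdot,y)$. Constant: $C(\alpha,\lambda)=\frac{\lambda}{(1+\alpha)^2}\bigl(\frac{2-\lambda}{2}-\alpha\,m\bigr)$, where $m=\max\{\alpha-\frac\lambda2,0\}$ if $(Af)$ is convex and $m=1$ otherwise. Algorithm 2 (linesearch ADMM). Inputs: $(x^{-1},y^{-1},z^{-1})\in\mathbb{R}^m\times\mathbb{R}^p\times\mathbb{R}^n$, tolerance $\varepsilon$, relaxation $\lambda\in(0,2)$, $i_{\max}\in\mathbb{N}\cup\{\infty\}$. In the smooth case set $\pi=1$, take $\beta>L_{(Af)}$ if $f$ is convex and $\beta>\frac{2L_{(Af)}}{2-\lambda}$ otherwise, and $0<c<C(L_{(Af)}/\beta,\lambda)$. In the strongly convex case set $\pi=-1$, take $0<\beta<\mu_f/\|A\|^2$ and $0<c<C(\beta\|A\|^2/\mu_f,\lambda)$. Initialize $k=0$, $r^{-1}=Ax^{-1}+Bz^{-1}-b$, $y^{-1/2}=y^{-1}-\beta(1-\lambda)r^{-1}$, $(x^0,y^0,z^0)\in\mathrm{ADMM}_\beta(y^{-1/2},z^{-1})$.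 (1) $r^k=Ax^k+Bz^k-b$; if $\beta\|r^k\|\le\varepsilon$, stop and return $(x^k,y^k,z^k)$. (2) $\bar y^{k+1/2}=y^k-\beta(1-\lambda)r^k$. (3) Select an arbitrary direction $d^k\in\mathbb{R}^p$; set $\tau_k=1$, $i_k=0$. (4) $y^{k+1/2}=(1-\tau_k)\bar y^{k+1/2}+\tau_k\bigl(y^k-\beta(r^k+d^k)\bigr)$. (5) Compute $(x^{k+1},y^{k+1},z^{k+1})\in\mathrm{ADMM}_\beta(y^{k+1/2},z^k)$. (6) If $\pi\mathscr L_\beta(x^{k+1},z^{k+1},y^{k+1})\le\pi\mathscr L_\beta(x^k,z^k,y^k)-\beta c\|r^k\|^2$: $k\leftarrow k+1$ and go to (1). (7) Otherwise, if $i_k=i_{\max}$: set $y^{k+1/2}=\bar y^{k+1/2}$, $(x^{k+1},y^{k+1},z^{k+1})\in\mathrm{ADMM}_\beta(\bar y^{k+1/2},z^k)$, $k\leftarrow k+1$ and go to (1). (8) Otherwise (backtrack): $\tau_k\leftarrow\tau_k/2$, $i_k\leftarrow i_k+1$ and go to (4). The iterates are those of a run of the algorithm, in which arbitrary elements of the oracle sets are selected. *)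

theory Defs
  imports "HOL-Analysis.Analysis"
begin

section \<open>Extended-real-valued functions\<close>

definition eff_dom :: "('a \<Rightarrow> ereal) \<Rightarrow> 'a set" where
  "eff_dom h = {x. h x < \<infinity>}"

definition proper_fun :: "('a \<Rightarrow> ereal) \<Rightarrow> bool" where
  "proper_fun h \<longleftrightarrow> eff_dom h \<noteq> {} \<and> (\<forall>x. h x \<noteq> -\<infinity>)"

definition lsc_fun :: "('a::topological_space \<Rightarrow> ereal) \<Rightarrow> bool" where
  "lsc_fun h \<longleftrightarrow> (\<forall>x. h x \<le> Liminf (at x) h)"

definition convex_fun :: "('a::real_vector \<Rightarrow> ereal) \<Rightarrow> bool" where
  "convex_fun h \<longleftrightarrow> (\<forall>x y t. 0 < t \<and> t < 1 \<longrightarrow>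
     h ((1 - t) *\<^sub>R x + t *\<^sub>R y) \<le> ereal (1 - t) * h x + ereal t * h y)"

definition strongly_convex_fun :: "real \<Rightarrow> ('a::real_inner \<Rightarrow> ereal) \<Rightarrow> bool" where
  "strongly_convex_fun \<mu> h \<longleftrightarrow> \<mu> > 0 \<and> convex_fun (\<lambda>x. h x - ereal (\<mu> / 2 * (norm x)\<^sup>2))"

text \<open>The usual convention of variational analysis: the set of minimizers of a function that is
  identically \<open>\<infinity>\<close> is empty.\<close>

definition argmin :: "('a \<Rightarrow> ereal) \<Rightarrow> 'a set" where
  "argmin h = {x. h x < \<infinity> \<and> (\<forall>x'. h x \<le> h x')}"

text \<open>Infima are taken in \<^typ>\<open>ereal\<close>, so the infimum over an infeasible constraint set
  is \<open>\<infinity>\<close>.\<close>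

definition epicomp :: "real^'n^'p \<Rightarrow> (real^'n \<Rightarrow> ereal) \<Rightarrow> real^'p \<Rightarrow> ereal" where
  "epicomp C h s = (INF x\<in>{x. C *v x = s}. h x)"

text \<open>Subgradients exist only at points where the function is finite.\<close>

definition regular_subdiff :: "('a::real_inner \<Rightarrow> ereal) \<Rightarrow> 'a \<Rightarrow> 'a set" where
  "regular_subdiff h x0 = {v. \<bar>h x0\<bar> \<noteq> \<infinity> \<and>
     0 \<le> Liminf (at x0) (\<lambda>x. (h x - h x0 - ereal (v \<bullet> (x - x0))) / ereal (norm (x - x0)))}"

text \<open>Unlike \<^const>\<open>infdist\<close>, whose value is \<open>0\<close> there, the distance to the empty set
  is \<open>\<infinity>\<close>.\<close>

definition set_dist :: "'a::real_normed_vector \<Rightarrow> 'a set \<Rightarrow> ereal" where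
  "set_dist x E = (INF w\<in>E. ereal (norm (w - x)))"

text \<open>The spectral norm; \<^const>\<open>norm\<close> on the matrix type is the Frobenius norm.\<close>

definition op_norm :: "real^'n^'p \<Rightarrow> real" where
  "op_norm C = onorm (\<lambda>x. C *v x)"


section \<open>The problem and its assumptions\<close>

definition Phi :: "(real^'m \<Rightarrow> ereal) \<Rightarrow> (real^'n \<Rightarrow> ereal) \<Rightarrow> real^'m^'p \<Rightarrow> real^'n^'p \<Rightarrow> real^'p
    \<Rightarrow> (real^'m) \<times> (real^'n) \<Rightarrow> ereal" where
  "Phi f g A B b = (\<lambda>(x, z). if A *v x + B *v z = b then f x + g z else \<infinity>)"

definition min_Phi :: "(real^'m \<Rightarrow> ereal) \<Rightarrow> (real^'n \<Rightarrow> ereal) \<Rightarrow> real^'m^'p \<Rightarrow> real^'n^'p \<Rightarrow> real^'p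
    \<Rightarrow> ereal" where
  "min_Phi f g A B b = (INF w. Phi f g A B b w)"

definition smooth_case :: "(real^'m \<Rightarrow> ereal) \<Rightarrow> (real^'n \<Rightarrow> ereal) \<Rightarrow> real^'m^'p \<Rightarrow> real^'n^'p
    \<Rightarrow> real^'p \<Rightarrow> real \<Rightarrow> bool" where
  "smooth_case f g A B b L \<longleftrightarrow>
     (\<forall>x. \<bar>f x\<bar> \<noteq> \<infinity>) \<and> (\<forall>z. g z \<noteq> -\<infinity>) \<and>
     rank A = CARD('p) \<and>
     (\<forall>s. \<bar>epicomp A f s\<bar> \<noteq> \<infinity>) \<and>
     (\<exists>G. (\<forall>s. GDERIV (\<lambda>s. real_of_ereal (epicomp A f s)) s :> G s) \<and> L-lipschitz_on UNIV G) \<and>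
     (\<forall>s. epicomp B g s \<noteq> -\<infinity>) \<and> lsc_fun (epicomp B g) \<and>
     argmin (Phi f g A B b) \<noteq> {}"

definition strongly_convex_case :: "(real^'m \<Rightarrow> ereal) \<Rightarrow> (real^'n \<Rightarrow> ereal) \<Rightarrow> real^'m^'p
    \<Rightarrow> real^'n^'p \<Rightarrow> real^'p \<Rightarrow> real \<Rightarrow> bool" where
  "strongly_convex_case f g A B b \<mu> \<longleftrightarrow>
     lsc_fun f \<and> proper_fun f \<and> strongly_convex_fun \<mu> f \<and>
     lsc_fun (epicomp B g) \<and> proper_fun (epicomp B g) \<and> convex_fun (epicomp B g) \<and>
     b \<in> rel_interior {A *v x + B *v z | x z. x \<in> eff_dom f \<and> z \<in> eff_dom g}"


section \<open>ADMM\<close>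

definition aug_lagrangian :: "(real^'m \<Rightarrow> ereal) \<Rightarrow> (real^'n \<Rightarrow> ereal) \<Rightarrow> real^'m^'p \<Rightarrow> real^'n^'p
    \<Rightarrow> real^'p \<Rightarrow> real \<Rightarrow> real^'m \<Rightarrow> real^'n \<Rightarrow> real^'p \<Rightarrow> ereal" where
  "aug_lagrangian f g A B b \<beta> x z y = f x + g z +
     ereal (y \<bullet> (A *v x + B *v z - b) + \<beta> / 2 * (norm (A *v x + B *v z - b))\<^sup>2)"

text \<open>In the \<open>x\<close>-step the term \<open>g z\<close> of the augmented Lagrangian does not depend
  on \<open>x\<close>. It is replaced by \<open>0\<close>, which leaves the minimizers unchanged when \<open>g z < \<infinity>\<close> and
  keeps the step meaningful when \<open>g z = \<infinity>\<close>: the initial \<open>z\<close> of the algorithm is arbitrary and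
  may lie outside the domain of \<open>g\<close>.\<close>

definition ADMM :: "(real^'m \<Rightarrow> ereal) \<Rightarrow> (real^'n \<Rightarrow> ereal) \<Rightarrow> real^'m^'p \<Rightarrow> real^'n^'p \<Rightarrow> real^'p
    \<Rightarrow> real \<Rightarrow> real^'p \<Rightarrow> real^'n \<Rightarrow> ((real^'m) \<times> (real^'p) \<times> (real^'n)) set" where
  "ADMM f g A B b \<beta> y' z' = {(x, y, z).
     x \<in> argmin (\<lambda>x. aug_lagrangian f (\<lambda>_. 0) A B b \<beta> x z' y') \<and>
     y = y' + \<beta> *\<^sub>R (A *v x + B *v z' - b) \<and>
     z \<in> argmin (\<lambda>z. aug_lagrangian f g A B b \<beta> x z y)}"

definition C_const :: "(real^'m \<Rightarrow> ereal) \<Rightarrow> real^'m^'p \<Rightarrow> real \<Rightarrow> real \<Rightarrow> real" where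
  "C_const f A \<alpha> lam = lam / (1 + \<alpha>)\<^sup>2 * ((2 - lam) / 2 -
     \<alpha> * (if convex_fun (epicomp A f) then max (\<alpha> - lam / 2) 0 else 1))"


section \<open>The linesearch algorithm as a transition system\<close>

text \<open>A control state carries the iteration counter \<open>k\<close> and the current iterate
  \<open>(x\<^sup>k, y\<^sup>k, z\<^sup>k)\<close>. \<open>Check\<close> is the state before the termination test, \<open>Trial\<close> the state
  before a candidate point is computed (with direction \<open>d\<^sub>k\<close>, stepsize \<open>\<tau>\<^sub>k\<close> and backtracking
  counter \<open>i\<^sub>k\<close>), \<open>Stopped\<close> the state in which the triplet has been returned.\<close>

datatype ('m, 'p, 'n) ls_state =
    Check nat "(real^'m) \<times> (real^'p) \<times> (real^'n)"
  | Trial nat "(real^'m) \<times> (real^'p) \<times> (real^'n)" "real^'p" real nat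
  | Stopped nat "(real^'m) \<times> (real^'p) \<times> (real^'n)"

definition residual :: "real^'m^'p \<Rightarrow> real^'n^'p \<Rightarrow> real^'p
    \<Rightarrow> (real^'m) \<times> (real^'p) \<times> (real^'n) \<Rightarrow> real^'p" where
  "residual A B b = (\<lambda>(x, y, z). A *v x + B *v z - b)"

definition nominal_y :: "real^'m^'p \<Rightarrow> real^'n^'p \<Rightarrow> real^'p \<Rightarrow> real \<Rightarrow> real
    \<Rightarrow> (real^'m) \<times> (real^'p) \<times> (real^'n) \<Rightarrow> real^'p" where
  "nominal_y A B b \<beta> lam = (\<lambda>(x, y, z). y - (\<beta> * (1 - lam)) *\<^sub>R residual A B b (x, y, z))"

definition trial_y :: "real^'m^'p \<Rightarrow> real^'n^'p \<Rightarrow> real^'p \<Rightarrow> real \<Rightarrow> real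
    \<Rightarrow> (real^'m) \<times> (real^'p) \<times> (real^'n) \<Rightarrow> real^'p \<Rightarrow> real \<Rightarrow> real^'p" where
  "trial_y A B b \<beta> lam = (\<lambda>(x, y, z) d \<tau>.
     (1 - \<tau>) *\<^sub>R nominal_y A B b \<beta> lam (x, y, z)
     + \<tau> *\<^sub>R (y - \<beta> *\<^sub>R (residual A B b (x, y, z) + d)))"

text \<open>The linesearch condition; \<open>sg\<close> is the sign \<open>\<pi>\<close>.\<close>

definition accepts :: "(real^'m \<Rightarrow> ereal) \<Rightarrow> (real^'n \<Rightarrow> ereal) \<Rightarrow> real^'m^'p \<Rightarrow> real^'n^'p \<Rightarrow> real^'p
    \<Rightarrow> real \<Rightarrow> real \<Rightarrow> real \<Rightarrow> (real^'m) \<times> (real^'p) \<times> (real^'n)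
    \<Rightarrow> (real^'m) \<times> (real^'p) \<times> (real^'n) \<Rightarrow> bool" where
  "accepts f g A B b \<beta> sg c = (\<lambda>(x, y, z) (x', y', z').
     ereal sg * aug_lagrangian f g A B b \<beta> x' z' y'
       \<le> ereal sg * aug_lagrangian f g A B b \<beta> x z y
          - ereal (\<beta> * c * (norm (residual A B b (x, y, z)))\<^sup>2))"

inductive ls_step :: "(real^'m \<Rightarrow> ereal) \<Rightarrow> (real^'n \<Rightarrow> ereal) \<Rightarrow> real^'m^'p \<Rightarrow> real^'n^'p \<Rightarrow> real^'p
    \<Rightarrow> real \<Rightarrow> real \<Rightarrow> real \<Rightarrow> real \<Rightarrow> real \<Rightarrow> enat
    \<Rightarrow> ('m, 'p, 'n) ls_state \<Rightarrow> ('m, 'p, 'n) ls_state \<Rightarrow> bool"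
  for f g A B b \<beta> sg c lam \<epsilon> imax where
  stop: "\<beta> * norm (residual A B b w) \<le> \<epsilon> \<Longrightarrow>
    ls_step f g A B b \<beta> sg c lam \<epsilon> imax (Check k w) (Stopped k w)"
| select_direction: "\<not> \<beta> * norm (residual A B b w) \<le> \<epsilon> \<Longrightarrow>
    ls_step f g A B b \<beta> sg c lam \<epsilon> imax (Check k w) (Trial k w d 1 0)"
| accept: "w' \<in> ADMM f g A B b \<beta> (trial_y A B b \<beta> lam (x, y, z) d \<tau>) z \<Longrightarrow>
    accepts f g A B b \<beta> sg c (x, y, z) w' \<Longrightarrow>
    ls_step f g A B b \<beta> sg c lam \<epsilon> imax (Trial k (x, y, z) d \<tau> i) (Check (Suc k) w')"
| fallback: "w' \<in> ADMM f g A B b \<beta> (trial_y A B b \<beta> lam (x, y, z) d \<tau>) z \<Longrightarrow>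
    \<not> accepts f g A B b \<beta> sg c (x, y, z) w' \<Longrightarrow>
    enat i = imax \<Longrightarrow>
    w'' \<in> ADMM f g A B b \<beta> (nominal_y A B b \<beta> lam (x, y, z)) z \<Longrightarrow>
    ls_step f g A B b \<beta> sg c lam \<epsilon> imax (Trial k (x, y, z) d \<tau> i) (Check (Suc k) w'')"
| backtrack: "w' \<in> ADMM f g A B b \<beta> (trial_y A B b \<beta> lam (x, y, z) d \<tau>) z \<Longrightarrow>
    \<not> accepts f g A B b \<beta> sg c (x, y, z) w' \<Longrightarrow>
    enat i \<noteq> imax \<Longrightarrow>
    ls_step f g A B b \<beta> sg c lam \<epsilon> imax
      (Trial k (x, y, z) d \<tau> i) (Trial k (x, y, z) d (\<tau> / 2) (Suc i))"

text \<open>A run started from the input \<open>w_in\<close>, with first iterate \<open>w0\<close>: an infinite sequence of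
  states, constant once \<open>Stopped\<close> has been reached. Neither termination of the outer loop nor
  finiteness of the linesearch loop is built in; a run only presupposes that each oracle call
  returns some element.\<close>

definition ls_run :: "(real^'m \<Rightarrow> ereal) \<Rightarrow> (real^'n \<Rightarrow> ereal) \<Rightarrow> real^'m^'p \<Rightarrow> real^'n^'p \<Rightarrow> real^'p
    \<Rightarrow> real \<Rightarrow> real \<Rightarrow> real \<Rightarrow> real \<Rightarrow> real \<Rightarrow> enat
    \<Rightarrow> (real^'m) \<times> (real^'p) \<times> (real^'n) \<Rightarrow> (real^'m) \<times> (real^'p) \<times> (real^'n)
    \<Rightarrow> (nat \<Rightarrow> ('m, 'p, 'n) ls_state) \<Rightarrow> bool" where
  "ls_run f g A B b \<beta> sg c lam \<epsilon> imax w_in w0 \<sigma> \<longleftrightarrow>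
     w0 \<in> ADMM f g A B b \<beta> (nominal_y A B b \<beta> lam w_in) (snd (snd w_in)) \<and>
     \<sigma> 0 = Check 0 w0 \<and>
     (\<forall>t. ls_step f g A B b \<beta> sg c lam \<epsilon> imax (\<sigma> t) (\<sigma> (Suc t)) \<or>
          (\<exists>k w. \<sigma> t = Stopped k w \<and> \<sigma> (Suc t) = Stopped k w))"

text \<open>The times at which iteration \<open>k\<close> of a run backtracks: backtracking is the only transition
  between two \<open>Trial\<close> states.\<close>

definition backtrackings :: "(nat \<Rightarrow> ('m::finite, 'p::finite, 'n::finite) ls_state) \<Rightarrow> nat \<Rightarrow> nat set" where
  "backtrackings \<sigma> k = {t. \<exists>w d \<tau> i w' d' \<tau>' i'.
     \<sigma> t = Trial k w d \<tau> i \<and> \<sigma> (Suc t) = Trial k w' d' \<tau>' i'}"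

end

theory Submission
  imports Defs
begin

text \<open>
  In the variable \<open>s = A x - y / \<beta>\<close> an ADMM step is a step of Douglas-Rachford splitting: the
  nominal multiplier gives \<open>s' = s - lam r\<close> with the residual \<open>r\<close>, and a trial step deviates from
  this by \<open>e = \<tau> (lam r + d)\<close>. The augmented Lagrangian at the output is the Douglas-Rachford
  envelope at \<open>s\<close>, and it serves as a merit function.

  The core of the proof is an estimate for two arbitrary outputs of ADMM steps. The
  Lagrangian improves by at least \<open>progress\<close>, an explicit continuous function of \<open>r\<close> and the
  deviation \<open>e\<close> which at \<open>e = 0\<close> equals \<open>\<beta> C \<parallel>r\<parallel>\<^sup>2\<close> with a constant \<open>C > c\<close>. In the smooth case
  (\<open>smooth_progress\<close>) it decreases: the Lagrangian is compared at the old \<open>z\<close>, and the gradient of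
  the epicomposition of \<open>f\<close> is Lipschitz. In the strongly convex case (\<open>strongly_convex_progress\<close>)
  it increases: this is the same estimate for the dual problem, in which multiplier and \<open>A x\<close>
  exchange their roles, but it is obtained from subgradient inequalities without conjugates. Both
  reduce to the same algebra, \<open>progress_le_gain\<close>.

  Carrying the deviation \<open>e\<close> through the estimate settles the linesearch as well. If \<open>r\<close> is nonzero,
  then \<open>progress\<close> exceeds \<open>\<beta> c \<parallel>r\<parallel>\<^sup>2\<close> as soon as \<open>\<tau>\<close> is small (\<open>eventually_accepts\<close>), so backtracking
  ends whichever outputs are selected; at \<open>e = 0\<close> it shows that the fallback step
  meets the linesearch condition too (\<open>nominal_decrease\<close>). Hence every iteration that does not stop,
  and so has \<open>\<parallel>r\<parallel> > \<epsilon> / \<beta>\<close>, improves the Lagrangian by \<open>c \<epsilon>\<^sup>2 / \<beta>\<close>. The optimal value bounds the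
  Lagrangian from the side it moves to (\<open>smooth_min_Phi_le\<close>, \<open>strongly_convex_le_min_Phi\<close>), which
  bounds the number of iterations. The KKT conditions at the returned point are the first-order
  optimality conditions of the two subproblems; the multiplier in the second one is \<open>y + \<beta> r\<close>
  instead of \<open>y\<close>, whence the error \<open>\<parallel>B\<parallel> \<epsilon>\<close>.
\<close>

section \<open>Optimality of the ADMM subproblems\<close>

text \<open>Both subproblems of an ADMM step minimize \<open>h\<close> plus a quadratic in \<open>C x\<close>. Expanding the quadratic
around the minimizer \<open>x\<close> leaves its gradient \<open>p\<close> there and its curvature \<open>\<beta>\<close>, while the multiplier
and the other block, the arguments of the subproblem, disappear. For convex data the inequality
says that \<open>- p\<close> is a subgradient at \<open>C x\<close> of the epicomposition of \<open>h\<close> with \<open>C\<close>.\<close>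

definition prox_opt :: "('a \<Rightarrow> ereal) \<Rightarrow> ('a \<Rightarrow> 'b::real_inner) \<Rightarrow> real \<Rightarrow> 'b \<Rightarrow> 'a \<Rightarrow> bool" where
  "prox_opt h C \<beta> p x \<longleftrightarrow> \<bar>h x\<bar> \<noteq> \<infinity> \<and>
     (\<forall>x'. h x \<le> h x' + ereal (p \<bullet> (C x' - C x) + \<beta> / 2 * (norm (C x' - C x))\<^sup>2))"

lemma prox_opt_not_MInf:
  assumes "prox_opt h C \<beta> p x" shows "h x' \<noteq> -\<infinity>"
proof
  assume "h x' = -\<infinity>"
  moreover have "h x \<le> h x' + ereal (p \<bullet> (C x' - C x) + \<beta> / 2 * (norm (C x' - C x))\<^sup>2)"
    and "\<bar>h x\<bar> \<noteq> \<infinity>"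
    using assms by (simp_all add: prox_opt_def)
  ultimately show False by (cases "h x") auto
qed

lemma quadratic_increment:
  fixes y c u u' :: "'a::real_inner"
  shows "(y \<bullet> (u' + c) + \<beta> / 2 * (norm (u' + c))\<^sup>2) - (y \<bullet> (u + c) + \<beta> / 2 * (norm (u + c))\<^sup>2)
    = (y + \<beta> *\<^sub>R (u + c)) \<bullet> (u' - u) + \<beta> / 2 * (norm (u' - u))\<^sup>2"
  unfolding power2_norm_eq_inner
  by (simp add: inner_simps inner_commute algebra_simps)

lemma prox_optI:
  fixes C :: "'a \<Rightarrow> 'b::real_inner"
  assumes fin: "h x < \<infinity>" "h x \<noteq> -\<infinity>"
    and min: "\<And>x'. h x + ereal (y \<bullet> (C x + c) + \<beta> / 2 * (norm (C x + c))\<^sup>2)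
                 \<le> h x' + ereal (y \<bullet> (C x' + c) + \<beta> / 2 * (norm (C x' + c))\<^sup>2)"
  shows "prox_opt h C \<beta> (y + \<beta> *\<^sub>R (C x + c)) x"
  unfolding prox_opt_def
proof (intro conjI allI)
  show "\<bar>h x\<bar> \<noteq> \<infinity>" using fin by auto
  fix x'
  show "h x \<le> h x' + ereal ((y + \<beta> *\<^sub>R (C x + c)) \<bullet> (C x' - C x) + \<beta> / 2 * (norm (C x' - C x))\<^sup>2)"
    using min[of x'] fin unfolding quadratic_increment[symmetric]
    by (cases "h x"; cases "h x'") auto
qed

text \<open>An ADMM step thus leaves two conditions that only mention the new triplet. The gradient is \<open>y\<close> for
the first block because the multiplier update is exactly the gradient of its penalty term, and
\<open>y + \<beta> r\<close> for the second block, whose subproblem is solved after that update. The difference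
\<open>\<beta> r\<close> is the error in the second KKT condition.\<close>

lemma ADMM_optimality:
  fixes f :: "real^'m \<Rightarrow> ereal" and g :: "real^'n \<Rightarrow> ereal"
  assumes mem: "(x, y, z) \<in> ADMM f g A B b \<beta> y' z'"
    and f: "\<And>x. f x \<noteq> -\<infinity>" and g: "\<And>z. g z \<noteq> -\<infinity>"
  shows "prox_opt f ((*v) A) \<beta> y x"
    and "prox_opt g ((*v) B) \<beta> (y + \<beta> *\<^sub>R (A *v x + B *v z - b)) z"
    and "y = y' + \<beta> *\<^sub>R (A *v x + B *v z' - b)"
proof -
  have x: "x \<in> argmin (\<lambda>x. aug_lagrangian f (\<lambda>_. 0) A B b \<beta> x z' y')"
    and y: "y = y' + \<beta> *\<^sub>R (A *v x + B *v z' - b)"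
    and z: "z \<in> argmin (\<lambda>z. aug_lagrangian f g A B b \<beta> x z y)"
    using mem unfolding ADMM_def by auto
  show "y = y' + \<beta> *\<^sub>R (A *v x + B *v z' - b)" by (rule y)
  have fx: "f x < \<infinity>" using x unfolding argmin_def aug_lagrangian_def by (cases "f x") auto
  have "prox_opt f ((*v) A) \<beta> (y' + \<beta> *\<^sub>R (A *v x + (B *v z' - b))) x"
    using x unfolding argmin_def aug_lagrangian_def
    by (intro prox_optI fx f) (auto simp: algebra_simps)
  then show "prox_opt f ((*v) A) \<beta> y x" unfolding y by (simp add: algebra_simps)
  have gz: "g z < \<infinity>" using z f[of x] unfolding argmin_def aug_lagrangian_def
    by (cases "f x"; cases "g z") auto
  have "prox_opt g ((*v) B) \<beta> (y + \<beta> *\<^sub>R (B *v z + (A *v x - b))) z"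
  proof (intro prox_optI gz g)
    fix z''
    have "f x + g z + ereal (y \<bullet> (A *v x + B *v z - b) + \<beta> / 2 * (norm (A *v x + B *v z - b))\<^sup>2)
      \<le> f x + g z'' + ereal (y \<bullet> (A *v x + B *v z'' - b) + \<beta> / 2 * (norm (A *v x + B *v z'' - b))\<^sup>2)"
      using z unfolding argmin_def aug_lagrangian_def by auto
    moreover have "A *v x + B *v w - b = B *v w + (A *v x - b)" for w by simp
    ultimately show "g z + ereal (y \<bullet> (B *v z + (A *v x - b)) + \<beta> / 2 * (norm (B *v z + (A *v x - b)))\<^sup>2)
        \<le> g z'' + ereal (y \<bullet> (B *v z'' + (A *v x - b)) + \<beta> / 2 * (norm (B *v z'' + (A *v x - b)))\<^sup>2)"
      using f[of x] fx gz g[of z] g[of z'']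
      by (cases "f x"; cases "g z"; cases "g z''") auto
  qed
  then show "prox_opt g ((*v) B) \<beta> (y + \<beta> *\<^sub>R (A *v x + B *v z - b)) z"
    by (simp add: algebra_simps)
qed

lemma norm_transpose_mult_le:
  fixes C :: "real^'n^'p"
  shows "norm (transpose C *v w) \<le> op_norm C * norm w"
proof (cases "transpose C *v w = 0")
  case True
  then show ?thesis unfolding op_norm_def by (simp add: onorm_pos_le matrix_vector_mul_bounded_linear)
next
  case False
  let ?v = "transpose C *v w"
  have "norm ?v * norm ?v = w \<bullet> (C *v ?v)"
    by (metis dot_lmul_matrix power2_eq_square power2_norm_eq_inner transpose_matrix_vector)
  also have "\<dots> \<le> norm w * (op_norm C * norm ?v)"
    by (rule order_trans[OF norm_cauchy_schwarz])
      (simp add: op_norm_def mult_left_mono onorm matrix_vector_mul_bounded_linear)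
  finally show ?thesis using False by (simp add: mult.assoc mult.left_commute)
qed

lemma norm_mult_le:
  fixes C :: "real^'n^'p"
  shows "norm (C *v x) \<le> op_norm C * norm x"
  unfolding op_norm_def by (simp add: onorm matrix_vector_mul_bounded_linear)

text \<open>The quadratic term of the proximal inequality is \<open>O(\<parallel>x' - x\<parallel>\<^sup>2)\<close>, so it vanishes in the difference
quotient.\<close>

lemma prox_opt_regular_subdiff:
  fixes C :: "real^'n^'p"
  assumes opt: "prox_opt h ((*v) C) \<beta> p x"
  shows "- (transpose C *v p) \<in> regular_subdiff h x"
  unfolding regular_subdiff_def
proof (intro CollectI conjI)
  let ?v = "- (transpose C *v p)"
  let ?K = "\<bar>\<beta>\<bar> / 2 * (op_norm C)\<^sup>2"
  show fin: "\<bar>h x\<bar> \<noteq> \<infinity>" using opt unfolding prox_opt_def by simp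
  have "((\<lambda>x'. - ?K * norm (x' - x)) \<longlongrightarrow> - ?K * norm (x - x)) (at x)"
    by (intro tendsto_intros)
  then have "((\<lambda>x'. ereal (- ?K * norm (x' - x))) \<longlongrightarrow> 0) (at x)"
    unfolding zero_ereal_def by (simp del: ereal_eq_0)
  then have "0 = Liminf (at x) (\<lambda>x'. ereal (- ?K * norm (x' - x)))"
    by (intro lim_imp_Liminf[symmetric]) (auto simp: trivial_limit_def[symmetric])
  also have "\<dots> \<le> Liminf (at x) (\<lambda>x'. (h x' - h x - ereal (?v \<bullet> (x' - x))) / ereal (norm (x' - x)))"
  proof (rule Liminf_mono)
    show "\<forall>\<^sub>F x' in at x. ereal (- ?K * norm (x' - x))
        \<le> (h x' - h x - ereal (?v \<bullet> (x' - x))) / ereal (norm (x' - x))"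
      unfolding eventually_at_filter
    proof (intro always_eventually allI impI)
      fix x' assume "x' \<noteq> x"
      then have pos: "norm (x' - x) > 0" by simp
      show "ereal (- ?K * norm (x' - x)) \<le> (h x' - h x - ereal (?v \<bullet> (x' - x))) / ereal (norm (x' - x))"
      proof (cases "h x'")
        case PInf
        then show ?thesis using fin pos by (cases "h x") auto
      next
        case MInf
        then show ?thesis using prox_opt_not_MInf[OF opt] by blast
      next
        case (real a)
        obtain a0 where a0: "h x = ereal a0" using fin by (cases "h x") auto
        have lin: "C *v x' - C *v x = C *v (x' - x)" by (simp add: matrix_vector_mult_diff_distrib)
        have v: "?v \<bullet> (x' - x) = - (p \<bullet> (C *v (x' - x)))"
          by (simp add: dot_lmul_matrix transpose_matrix_vector)
        have "h x \<le> h x' + ereal (p \<bullet> (C *v x' - C *v x) + \<beta> / 2 * (norm (C *v x' - C *v x))\<^sup>2)"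
          using opt unfolding prox_opt_def by blast
        then have 1: "a0 \<le> a + p \<bullet> (C *v (x' - x)) + \<beta> / 2 * (norm (C *v (x' - x)))\<^sup>2"
          unfolding real a0 lin by simp
        have "\<beta> / 2 * (norm (C *v (x' - x)))\<^sup>2 \<le> \<bar>\<beta>\<bar> / 2 * (op_norm C * norm (x' - x))\<^sup>2"
          by (intro mult_mono power_mono norm_mult_le) auto
        then have "- ?K * norm (x' - x) * norm (x' - x) \<le> a - a0 - ?v \<bullet> (x' - x)"
          using 1 unfolding v by (simp add: power2_eq_square algebra_simps)
        then have "- ?K * norm (x' - x) \<le> (a - a0 - ?v \<bullet> (x' - x)) / norm (x' - x)"
          using pos by (simp add: pos_le_divide_eq del: minus_mult_left)
        then show ?thesis unfolding real a0 using pos by simp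
      qed
    qed
  qed
  finally show "0 \<le> Liminf (at x) (\<lambda>x'. (h x' - h x - ereal (?v \<bullet> (x' - x))) / ereal (norm (x' - x)))" .
qed

lemma prox_opt_set_dist:
  fixes C :: "real^'n^'p"
  assumes opt: "prox_opt h ((*v) C) \<beta> (y + w) x"
  shows "set_dist (- (transpose C *v y)) (regular_subdiff h x) \<le> ereal (op_norm C * norm w)"
  unfolding set_dist_def
proof (rule INF_lower2[OF prox_opt_regular_subdiff[OF opt]])
  have "- (transpose C *v (y + w)) - - (transpose C *v y) = - (transpose C *v w)"
    by (simp add: matrix_vector_right_distrib)
  then show "ereal (norm (- (transpose C *v (y + w)) - - (transpose C *v y)))
      \<le> ereal (op_norm C * norm w)"
    using norm_transpose_mult_le[of C w] by simp
qed

text \<open>Since the proximal inequality sees \<open>x'\<close> only through \<open>C x'\<close>, it may be minimized over each fibre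
of \<open>C\<close>: the minimizer attains the epicomposition, and the inequality descends to it. This is what
allows hypotheses on the epicompositions to be used.\<close>

lemma prox_opt_epicomp:
  assumes opt: "prox_opt h ((*v) C) \<beta> p x"
  shows "epicomp C h (C *v x) = h x" and "prox_opt (epicomp C h) (\<lambda>s. s) \<beta> p (C *v x)"
proof -
  have le: "h x \<le> h x' + ereal (p \<bullet> (C *v x' - C *v x) + \<beta> / 2 * (norm (C *v x' - C *v x))\<^sup>2)" for x'
    using opt unfolding prox_opt_def by blast
  have fin: "\<bar>h x\<bar> \<noteq> \<infinity>" using opt unfolding prox_opt_def by simp
  show eq: "epicomp C h (C *v x) = h x"
    unfolding epicomp_def
  proof (rule antisym)
    show "(INF x'\<in>{x'. C *v x' = C *v x}. h x') \<le> h x" by (rule INF_lower) simp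
    show "h x \<le> (INF x'\<in>{x'. C *v x' = C *v x}. h x')"
    proof (rule INF_greatest)
      fix x' assume "x' \<in> {x'. C *v x' = C *v x}"
      then show "h x \<le> h x'" using le[of x'] by (simp flip: zero_ereal_def)
    qed
  qed
  show "prox_opt (epicomp C h) (\<lambda>s. s) \<beta> p (C *v x)"
    unfolding prox_opt_def eq
  proof (intro conjI fin allI)
    fix s
    let ?q = "p \<bullet> (s - C *v x) + \<beta> / 2 * (norm (s - C *v x))\<^sup>2"
    have "h x - ereal ?q \<le> epicomp C h s"
      unfolding epicomp_def
    proof (rule INF_greatest)
      fix x' assume "x' \<in> {x'. C *v x' = s}"
      then show "h x - ereal ?q \<le> h x'" using le[of x'] by (auto simp: ereal_minus_le_iff add.commute)
    qed
    then show "h x \<le> epicomp C h s + ereal ?q" by (simp add: ereal_minus_le_iff add.commute)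
  qed
qed

lemma le_if_le_add_small_multiple:
  fixes a X Y :: real
  assumes "\<And>t. 0 < t \<Longrightarrow> t < 1 \<Longrightarrow> a \<le> X + t * Y"
  shows "a \<le> X"
proof -
  have "((\<lambda>t. X + t * Y) \<longlongrightarrow> X + 0 * Y) (at_right 0)"
    by (intro tendsto_intros)
  moreover have "\<forall>\<^sub>F t in at_right (0::real). a \<le> X + t * Y"
    using assms by (auto simp: eventually_at_right_field intro!: exI[of _ 1])
  ultimately show ?thesis
    using tendsto_lowerbound[of "\<lambda>t. X + t * Y" "X + 0 * Y" "at_right 0" a] by simp
qed

section \<open>Convexity and Lipschitz gradients\<close>

text \<open>For a (strongly) convex function the proximal inequality, applied on the segment from \<open>x\<close> to \<open>x'\<close>
close to \<open>x\<close>, loses its quadratic term and gains the strong convexity term. The case \<open>\<mu> = 0\<close> is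
plain convexity.\<close>

lemma convex_prox_opt_subgradient:
  fixes h :: "'a::real_inner \<Rightarrow> ereal" and C :: "'a \<Rightarrow> 'b::real_inner"
  assumes lin: "linear C"
    and conv: "convex_fun (\<lambda>x. h x - ereal (\<mu> / 2 * (norm x)\<^sup>2))"
    and opt: "prox_opt h C \<beta> p x"
  shows "h x \<le> h x' + ereal (p \<bullet> (C x' - C x) - \<mu> / 2 * (norm (x' - x))\<^sup>2)"
proof (cases "h x'")
  case PInf
  then show ?thesis by simp
next
  case MInf
  then show ?thesis using prox_opt_not_MInf[OF opt] by blast
next
  case (real a')
  obtain a where a: "h x = ereal a" using opt by (cases "h x") (auto simp: prox_opt_def)
  have "a \<le> (a' + p \<bullet> (C x' - C x) - \<mu> / 2 * (norm (x' - x))\<^sup>2)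
      + t * (\<mu> / 2 * (norm (x' - x))\<^sup>2 + \<beta> / 2 * (norm (C x' - C x))\<^sup>2)"
    if t: "0 < t" "t < 1" for t
  proof -
    define xt where "xt = (1 - t) *\<^sub>R x + t *\<^sub>R x'"
    have Cxt: "C xt - C x = t *\<^sub>R (C x' - C x)"
      unfolding xt_def linear_add[OF lin] linear_scale[OF lin] by (simp add: algebra_simps)
    have nxt: "(norm xt)\<^sup>2 = (1 - t) * (norm x)\<^sup>2 + t * (norm x')\<^sup>2 - t * (1 - t) * (norm (x' - x))\<^sup>2"
      unfolding xt_def power2_norm_eq_inner by (simp add: inner_simps inner_commute algebra_simps)
    have cv: "h xt - ereal (\<mu> / 2 * (norm xt)\<^sup>2) \<le> ereal (1 - t) * (h x - ereal (\<mu> / 2 * (norm x)\<^sup>2))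
         + ereal t * (h x' - ereal (\<mu> / 2 * (norm x')\<^sup>2))"
      using conv t unfolding convex_fun_def xt_def by blast
    then obtain ht where ht: "h xt = ereal ht"
      using prox_opt_not_MInf[OF opt, of xt] unfolding real a by (cases "h xt") auto
    have 1: "ht \<le> (1 - t) * a + t * a' - \<mu> / 2 * t * (1 - t) * (norm (x' - x))\<^sup>2"
      using cv unfolding real a ht nxt by (simp add: algebra_simps diff_divide_distrib)
    have "h x \<le> h xt + ereal (p \<bullet> (C xt - C x) + \<beta> / 2 * (norm (C xt - C x))\<^sup>2)"
      using opt unfolding prox_opt_def by blast
    then have "a \<le> ht + t * (p \<bullet> (C x' - C x)) + \<beta> / 2 * t\<^sup>2 * (norm (C x' - C x))\<^sup>2"
      unfolding Cxt a ht by (simp add: power_mult_distrib)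
    with 1 have "t * a \<le> t * ((a' + p \<bullet> (C x' - C x) - \<mu> / 2 * (norm (x' - x))\<^sup>2)
      + t * (\<mu> / 2 * (norm (x' - x))\<^sup>2 + \<beta> / 2 * (norm (C x' - C x))\<^sup>2))"
      by (simp add: algebra_simps power2_eq_square diff_divide_distrib)
    then show ?thesis using t by simp
  qed
  from le_if_le_add_small_multiple[OF this] show ?thesis unfolding real a by simp
qed

lemma lipschitz_gradient_upper_bound:
  fixes \<phi> :: "'a::real_inner \<Rightarrow> real"
  assumes grad: "\<And>s. GDERIV \<phi> s :> G s" and lip: "L-lipschitz_on UNIV G"
  shows "\<phi> w \<le> \<phi> u + G u \<bullet> (w - u) + L / 2 * (norm (w - u))\<^sup>2"
proof -
  define d where "d = w - u"
  define k where "k t = \<phi> (u + t *\<^sub>R d) - t * (G u \<bullet> d) - L / 2 * t\<^sup>2 * (norm d)\<^sup>2" for t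
  have "(k has_real_derivative (G (u + t *\<^sub>R d) \<bullet> d - G u \<bullet> d - L * t * (norm d)\<^sup>2)) (at t)" for t
  proof -
    have "(\<phi> has_derivative (\<lambda>v. G (u + t *\<^sub>R d) \<bullet> v)) (at (u + t *\<^sub>R d))"
      using grad[of "u + t *\<^sub>R d"] unfolding gderiv_def by (simp add: inner_commute)
    moreover have "((\<lambda>t. u + t *\<^sub>R d) has_derivative (\<lambda>v. v *\<^sub>R d)) (at t)"
      by (auto intro!: derivative_eq_intros)
    ultimately have "((\<lambda>t. \<phi> (u + t *\<^sub>R d)) has_derivative (\<lambda>v. G (u + t *\<^sub>R d) \<bullet> (v *\<^sub>R d))) (at t)"
      by (rule has_derivative_compose[rotated])
    then have "((\<lambda>t. \<phi> (u + t *\<^sub>R d)) has_real_derivative (G (u + t *\<^sub>R d) \<bullet> d)) (at t)"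
      unfolding has_field_derivative_def by (rule has_derivative_eq_rhs) (auto simp: mult.commute)
    then show ?thesis
      unfolding k_def by (auto intro!: derivative_eq_intros simp: field_simps)
  qed
  moreover have "G (u + t *\<^sub>R d) \<bullet> d - G u \<bullet> d - L * t * (norm d)\<^sup>2 \<le> 0" if "0 \<le> t" for t
  proof -
    have "(G (u + t *\<^sub>R d) - G u) \<bullet> d \<le> norm (G (u + t *\<^sub>R d) - G u) * norm d"
      by (rule norm_cauchy_schwarz)
    also have "\<dots> \<le> (L * norm (t *\<^sub>R d)) * norm d"
      using lipschitz_onD[OF lip, of "u + t *\<^sub>R d" u] by (intro mult_right_mono) (auto simp: dist_norm)
    finally show ?thesis using that by (simp add: inner_diff_left power2_eq_square algebra_simps)
  qed
  ultimately have "k 1 \<le> k 0"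
    by (intro DERIV_nonpos_imp_nonincreasing[of 0 1 k]) (simp, blast)
  then show ?thesis unfolding k_def d_def by simp
qed

lemma lipschitz_gradient_lower_bound:
  fixes \<phi> :: "'a::real_inner \<Rightarrow> real"
  assumes grad: "\<And>s. GDERIV \<phi> s :> G s" and lip: "L-lipschitz_on UNIV G"
  shows "\<phi> w \<ge> \<phi> u + G u \<bullet> (w - u) - L / 2 * (norm (w - u))\<^sup>2"
proof -
  have "GDERIV (\<lambda>s. - \<phi> s) s :> - G s" for s
    using GDERIV_minus[OF grad] .
  moreover have "L-lipschitz_on UNIV (\<lambda>s. - G s)"
    using lip by simp
  ultimately have "- \<phi> w \<le> - \<phi> u + (- G u) \<bullet> (w - u) + L / 2 * (norm (w - u))\<^sup>2"
    by (rule lipschitz_gradient_upper_bound)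
  then show ?thesis by simp
qed

text \<open>The quadratic lower bound is a proximal inequality. Through it, \<open>convex_prox_opt_subgradient\<close>
also yields the gradient inequality of differentiable convex functions.\<close>

lemma lipschitz_gradient_prox_opt:
  fixes \<phi> :: "'a::real_inner \<Rightarrow> ereal"
  assumes fin: "\<And>s. \<bar>\<phi> s\<bar> \<noteq> \<infinity>"
    and grad: "\<And>s. GDERIV (\<lambda>s. real_of_ereal (\<phi> s)) s :> G s" and lip: "L-lipschitz_on UNIV G"
  shows "prox_opt \<phi> (\<lambda>s. s) L (- G u) u"
  unfolding prox_opt_def
proof (intro conjI fin allI)
  fix w
  obtain a a' where "\<phi> u = ereal a" "\<phi> w = ereal a'"
    using fin[of u] fin[of w] by (cases "\<phi> u"; cases "\<phi> w") auto
  then show "\<phi> u \<le> \<phi> w + ereal (- G u \<bullet> (w - u) + L / 2 * (norm (w - u))\<^sup>2)"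
    using lipschitz_gradient_lower_bound[OF grad lip, of u w] by simp
qed

text \<open>In the smooth case the multiplier is forced to be minus the gradient; moving from \<open>u\<close> against
\<open>p + G u\<close> would otherwise violate the proximal inequality to first order.\<close>

lemma prox_opt_gradient:
  fixes \<phi> :: "'a::real_inner \<Rightarrow> ereal"
  assumes fin: "\<And>s. \<bar>\<phi> s\<bar> \<noteq> \<infinity>"
    and grad: "\<And>s. GDERIV (\<lambda>s. real_of_ereal (\<phi> s)) s :> G s" and lip: "L-lipschitz_on UNIV G"
    and opt: "prox_opt \<phi> (\<lambda>s. s) \<beta> p u"
  shows "p = - G u"
proof -
  define d where "d = p + G u"
  have "(norm d)\<^sup>2 \<le> 0 + t * ((L + \<beta>) / 2 * (norm d)\<^sup>2)" if t: "0 < t" "t < 1" for t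
  proof -
    define w where "w = u - t *\<^sub>R d"
    obtain a a' where "\<phi> u = ereal a" "\<phi> w = ereal a'"
      using fin[of u] fin[of w] by (cases "\<phi> u"; cases "\<phi> w") auto
    moreover have "\<phi> u \<le> \<phi> w + ereal (p \<bullet> (w - u) + \<beta> / 2 * (norm (w - u))\<^sup>2)"
      using opt unfolding prox_opt_def by blast
    ultimately have "0 \<le> p \<bullet> (w - u) + G u \<bullet> (w - u) + (L + \<beta>) / 2 * (norm (w - u))\<^sup>2"
      using lipschitz_gradient_upper_bound[OF grad lip, of w u] by (simp add: field_simps)
    then have "0 \<le> d \<bullet> (w - u) + (L + \<beta>) / 2 * (norm (w - u))\<^sup>2"
      unfolding d_def by (simp add: inner_add_left)
    moreover have "d \<bullet> (w - u) = - (t * (norm d)\<^sup>2)" "(norm (w - u))\<^sup>2 = t * t * (norm d)\<^sup>2"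
      unfolding w_def by (simp_all add: power_mult_distrib power2_eq_square flip: power2_norm_eq_inner)
    ultimately have "0 \<le> - (t * (norm d)\<^sup>2) + (L + \<beta>) / 2 * (t * t * (norm d)\<^sup>2)" by (simp only:)
    then have "t * (norm d)\<^sup>2 \<le> (L + \<beta>) / 2 * (t * t * (norm d)\<^sup>2)" by simp
    also have "\<dots> = t * (t * ((L + \<beta>) / 2 * (norm d)\<^sup>2))" by (simp only: mult_ac)
    finally have "t * (norm d)\<^sup>2 \<le> t * (t * ((L + \<beta>) / 2 * (norm d)\<^sup>2))" .
    then show ?thesis using t by (simp only: add_0 mult_le_cancel_left_pos)
  qed
  then have "(norm d)\<^sup>2 \<le> 0" by (rule le_if_le_add_small_multiple)
  then show ?thesis unfolding d_def by (simp add: eq_neg_iff_add_eq_0)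
qed

text \<open>The estimate of Baillon and Haddad. The function \<open>v \<mapsto> D v w\<close> is nonnegative and
has an \<open>L\<close>-Lipschitz gradient, equal to \<open>G u - G w\<close> at \<open>u\<close>; a gradient step of length \<open>1 / L\<close>
from \<open>u\<close> therefore lowers it by at least \<open>\<parallel>G u - G w\<parallel>\<^sup>2 / (2 L)\<close>, and it cannot fall below zero.\<close>

lemma convex_lipschitz_gradient_cocoercive:
  fixes \<phi> :: "'a::real_inner \<Rightarrow> ereal"
  assumes fin: "\<And>s. \<bar>\<phi> s\<bar> \<noteq> \<infinity>"
    and grad: "\<And>s. GDERIV (\<lambda>s. real_of_ereal (\<phi> s)) s :> G s" and lip: "L-lipschitz_on UNIV G"
    and conv: "convex_fun \<phi>"
  defines "D \<equiv> \<lambda>u w. real_of_ereal (\<phi> u) - real_of_ereal (\<phi> w) - G w \<bullet> (u - w)"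
  shows "0 \<le> D u w" and "(norm (G u - G w))\<^sup>2 / 2 \<le> L * D u w"
proof -
  have conv0: "convex_fun (\<lambda>x. \<phi> x - ereal (0 / 2 * (norm x)\<^sup>2))" using conv by simp
  have nonneg: "0 \<le> D v w" for v
  proof -
    obtain a a' where "\<phi> w = ereal a" "\<phi> v = ereal a'"
      using fin[of v] fin[of w] by (cases "\<phi> w"; cases "\<phi> v") auto
    then show ?thesis
      using convex_prox_opt_subgradient[OF linear_ident conv0
          lipschitz_gradient_prox_opt[OF fin grad lip], of w v]
      unfolding D_def by simp
  qed
  show "0 \<le> D u w" by (rule nonneg)
  have L0: "L \<ge> 0" using lip by (rule lipschitz_on_nonneg)
  show "(norm (G u - G w))\<^sup>2 / 2 \<le> L * D u w"
  proof (cases "L = 0")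
    case True
    then have "G u = G w" using lipschitz_onD[OF lip, of u w] by simp
    then show ?thesis using True by simp
  next
    case False
    define q where "q = G u - G w"
    define v where "v = u - (1 / L) *\<^sub>R q"
    have "real_of_ereal (\<phi> v) \<le> real_of_ereal (\<phi> u) + G u \<bullet> (v - u) + L / 2 * (norm (v - u))\<^sup>2"
      by (rule lipschitz_gradient_upper_bound[OF grad lip])
    then have "D v w \<le> D u w + q \<bullet> (v - u) + L / 2 * (norm (v - u))\<^sup>2"
      unfolding D_def q_def by (simp add: inner_simps)
    moreover have "q \<bullet> (v - u) = - (norm q)\<^sup>2 / L" "L / 2 * (norm (v - u))\<^sup>2 = (norm q)\<^sup>2 / (2 * L)"
      unfolding v_def using False
      by (simp_all add: power2_norm_eq_inner[symmetric] power_mult_distrib power2_eq_square field_simps)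
    ultimately have "(norm q)\<^sup>2 / (2 * L) \<le> D u w" using nonneg[of v] by (simp add: field_simps)
    then show ?thesis using L0 False unfolding q_def by (simp add: field_simps)
  qed
qed

section \<open>The gain of a perturbed step\<close>

text \<open>The guaranteed gain of a step with residual \<open>r\<close> whose Douglas-Rachford variable misses the nominal
step by \<open>e\<close>. It is continuous in \<open>e\<close>, and at \<open>e = 0\<close> it equals
\<open>\<beta> \<parallel>r\<parallel>\<^sup>2\<close> times the constant that bounds \<open>c\<close>.\<close>

definition progress :: "real \<Rightarrow> real \<Rightarrow> real \<Rightarrow> real \<Rightarrow> 'a::real_inner \<Rightarrow> 'a \<Rightarrow> real" where
  "progress \<beta> lam \<alpha> \<kappa> r e = \<beta> / lam * (\<kappa> * (norm (e - lam *\<^sub>R r) / (1 + \<alpha>))\<^sup>2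
     - norm e * (1 + \<alpha>) / (1 - \<alpha>) * norm (e - lam *\<^sub>R r))"

lemma progress_unperturbed:
  "lam \<noteq> 0 \<Longrightarrow> progress \<beta> lam \<alpha> \<kappa> r 0 = \<beta> * (lam / (1 + \<alpha>)\<^sup>2 * \<kappa>) * (norm r)\<^sup>2"
  unfolding progress_def by (simp add: power_divide power_mult_distrib) (simp add: power2_eq_square)

text \<open>The algebra shared by the two cases. Here \<open>w1 + w2\<close> is the step of the Douglas-Rachford variable,
\<open>D\<close> is a Bregman distance of \<open>f\<close> or of its epicomposition, and \<open>w1\<close> is the dominant component: the step of \<open>A x\<close> in the
smooth case and the scaled step of the multiplier in the strongly convex case, in which the roles
of the two components are exchanged by duality. Taking the inner product of \<open>w2 - w1\<close> with
\<open>lam r = e - (w1 + w2)\<close> produces \<open>\<parallel>w1\<parallel>\<^sup>2 - \<parallel>w2\<parallel>\<^sup>2\<close>. The hypothesis on \<open>D\<close> turns this into a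
multiple of \<open>\<parallel>w1\<parallel>\<^sup>2\<close>, and \<open>\<parallel>w1\<parallel>\<close> is comparable with \<open>\<parallel>e - lam r\<parallel>\<close> because \<open>w2\<close> is the
smaller component.\<close>

lemma progress_le_gain:
  fixes w1 w2 e r :: "'a::real_inner"
  assumes par: "0 < \<beta>" "0 < lam" "0 \<le> \<alpha>" "\<alpha> < 1" "0 \<le> (2 - lam) / 2 - \<alpha> * m"
    and sum: "w1 + w2 = e - lam *\<^sub>R r"
    and w2: "norm w2 \<le> \<alpha> * norm w1"
    and D: "\<beta> * ((norm w2)\<^sup>2 - \<alpha> * m * (norm w1)\<^sup>2) \<le> lam * D"
    and gain: "D + \<beta> * ((w2 - w1) \<bullet> r) - \<beta> / 2 * (norm w1)\<^sup>2 \<le> \<Delta>"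
  shows "progress \<beta> lam \<alpha> ((2 - lam) / 2 - \<alpha> * m) r e \<le> \<Delta>"
proof -
  define \<kappa> where "\<kappa> = (2 - lam) / 2 - \<alpha> * m"
  define N where "N = norm (e - lam *\<^sub>R r)"
  have "N \<le> norm w1 + norm w2" unfolding N_def sum[symmetric] by (rule norm_triangle_ineq)
  then have N1: "N / (1 + \<alpha>) \<le> norm w1" using w2 par by (simp add: field_simps)
  have "norm w1 - norm w2 \<le> N" unfolding N_def sum[symmetric]
    using norm_diff_ineq[of w1 w2] by simp
  then have N2: "norm w1 \<le> N / (1 - \<alpha>)" using w2 par by (simp add: field_simps)
  have "lam * ((w2 - w1) \<bullet> r) = (w2 - w1) \<bullet> (e - (w1 + w2))"
    unfolding sum by simp
  also have "\<dots> = (w2 - w1) \<bullet> e + (norm w1)\<^sup>2 - (norm w2)\<^sup>2"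
    unfolding power2_norm_eq_inner by (simp add: inner_simps inner_commute)
  finally have r: "lam * ((w2 - w1) \<bullet> r) = (w2 - w1) \<bullet> e + (norm w1)\<^sup>2 - (norm w2)\<^sup>2" .
  have "- ((w2 - w1) \<bullet> e) \<le> norm (w2 - w1) * norm e"
    using norm_cauchy_schwarz[of "- (w2 - w1)" e] unfolding inner_minus_left norm_minus_cancel .
  also have "\<dots> \<le> ((1 + \<alpha>) * norm w1) * norm e"
    using norm_triangle_ineq4[of w2 w1] w2 by (intro mult_right_mono) (auto simp: algebra_simps)
  also have "\<dots> \<le> ((1 + \<alpha>) * (N / (1 - \<alpha>))) * norm e"
    using N2 par by (intro mult_right_mono mult_left_mono) auto
  finally have e: "- ((w2 - w1) \<bullet> e) \<le> norm e * (1 + \<alpha>) / (1 - \<alpha>) * N" by (simp add: algebra_simps)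
  have k: "\<kappa> * (N / (1 + \<alpha>))\<^sup>2 \<le> \<kappa> * (norm w1)\<^sup>2"
    using N1 par unfolding \<kappa>_def N_def by (intro mult_left_mono power_mono) auto
  have "\<beta> * (\<kappa> * (N / (1 + \<alpha>))\<^sup>2 - norm e * (1 + \<alpha>) / (1 - \<alpha>) * N)
      \<le> \<beta> * (\<kappa> * (norm w1)\<^sup>2 + (w2 - w1) \<bullet> e)"
    using k e par by (intro mult_left_mono) auto
  also have "\<dots> = \<beta> * ((norm w2)\<^sup>2 - \<alpha> * m * (norm w1)\<^sup>2) + \<beta> * (lam * ((w2 - w1) \<bullet> r))
      - lam * (\<beta> / 2 * (norm w1)\<^sup>2)"
    unfolding r \<kappa>_def by (simp add: field_simps)
  also have "\<dots> \<le> lam * D + \<beta> * (lam * ((w2 - w1) \<bullet> r)) - lam * (\<beta> / 2 * (norm w1)\<^sup>2)"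
    using D by simp
  also have "\<dots> = lam * (D + \<beta> * ((w2 - w1) \<bullet> r) - \<beta> / 2 * (norm w1)\<^sup>2)"
    by (simp add: algebra_simps)
  also have "\<dots> \<le> lam * \<Delta>" using gain par by (intro mult_left_mono) auto
  finally show ?thesis
    unfolding progress_def \<kappa>_def[symmetric] N_def[symmetric] using par by (simp add: field_simps)
qed

text \<open>The two sources of the bound on \<open>D\<close> in \<open>progress_le_gain\<close>, for the two values of the constant
\<open>m\<close>. Without convexity \<open>D\<close> may be negative, but not by more than the curvature allows.\<close>

lemma bregman_bound_weakly_convex:
  fixes n1 n2 :: real
  assumes "0 < \<beta>" "0 < lam" "0 \<le> \<alpha>" "\<alpha> + lam / 2 \<le> 1" "0 \<le> n2" "n2 \<le> \<alpha> * n1"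
    and "- (\<beta> * \<alpha> / 2 * n1\<^sup>2) \<le> D"
  shows "\<beta> * (n2\<^sup>2 - \<alpha> * 1 * n1\<^sup>2) \<le> lam * D"
proof -
  have "n2\<^sup>2 \<le> \<alpha>\<^sup>2 * n1\<^sup>2" using power_mono[OF assms(6,5), of 2] by (simp add: power_mult_distrib)
  moreover have "\<alpha> * (\<alpha> + lam / 2) * n1\<^sup>2 \<le> \<alpha> * 1 * n1\<^sup>2"
    using assms by (intro mult_right_mono mult_left_mono) auto
  ultimately have "n2\<^sup>2 - \<alpha> * 1 * n1\<^sup>2 \<le> - (lam * \<alpha> / 2 * n1\<^sup>2)"
    by (simp add: power2_eq_square algebra_simps)
  then have "\<beta> * (n2\<^sup>2 - \<alpha> * 1 * n1\<^sup>2) \<le> \<beta> * - (lam * \<alpha> / 2 * n1\<^sup>2)"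
    using assms by (intro mult_left_mono) auto
  also have "\<dots> = lam * - (\<beta> * \<alpha> / 2 * n1\<^sup>2)" by simp
  also have "\<dots> \<le> lam * D" using assms by (intro mult_left_mono) auto
  finally show ?thesis .
qed

text \<open>With convexity \<open>D\<close> compensates part of \<open>\<parallel>w2\<parallel>\<^sup>2\<close>. Any \<open>m\<close> above the convex constant is admitted
because in the strongly convex case both values of \<open>m\<close> are.\<close>

lemma bregman_bound_convex:
  fixes n1 n2 :: real
  assumes "0 < \<beta>" "0 < lam" "0 \<le> \<alpha>" "max (\<alpha> - lam / 2) 0 \<le> m" "0 \<le> n2" "n2 \<le> \<alpha> * n1"
    and D: "0 \<le> D" "\<beta> / 2 * n2\<^sup>2 \<le> \<alpha> * D"
  shows "\<beta> * (n2\<^sup>2 - \<alpha> * m * n1\<^sup>2) \<le> lam * D"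
proof (cases "\<alpha> = 0")
  case True
  then show ?thesis using assms by simp
next
  case False
  have sq: "n2\<^sup>2 \<le> \<alpha>\<^sup>2 * n1\<^sup>2" using power_mono[OF assms(6,5), of 2] by (simp add: power_mult_distrib)
  have "\<alpha> * n2\<^sup>2 - lam / 2 * n2\<^sup>2 \<le> m * n2\<^sup>2"
    using mult_right_mono[of "\<alpha> - lam / 2" m "n2\<^sup>2"] assms by (simp add: algebra_simps)
  also have "\<dots> \<le> m * (\<alpha>\<^sup>2 * n1\<^sup>2)" using assms sq by (intro mult_left_mono) auto
  finally have "\<alpha> * (n2\<^sup>2 - \<alpha> * m * n1\<^sup>2) \<le> lam / 2 * n2\<^sup>2"
    by (simp add: power2_eq_square algebra_simps)
  then have "\<beta> * (\<alpha> * (n2\<^sup>2 - \<alpha> * m * n1\<^sup>2)) \<le> lam * (\<beta> / 2 * n2\<^sup>2)"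
    using mult_left_mono[of "\<alpha> * (n2\<^sup>2 - \<alpha> * m * n1\<^sup>2)" "lam / 2 * n2\<^sup>2" \<beta>] assms(1)
    by (simp add: mult.left_commute)
  also have "\<dots> \<le> lam * (\<alpha> * D)" using assms by (intro mult_left_mono) auto
  finally have "\<alpha> * (\<beta> * (n2\<^sup>2 - \<alpha> * m * n1\<^sup>2)) \<le> \<alpha> * (lam * D)" by (simp add: algebra_simps)
  then show ?thesis using False assms(3) by simp
qed

section \<open>Two consecutive ADMM points\<close>

text \<open>The conditions that remain at an output of an ADMM step once its arguments are forgotten, see
\<open>ADMM_optimality\<close>. All estimates compare two such points.\<close>

definition admm_point :: "(real^'m \<Rightarrow> ereal) \<Rightarrow> (real^'n \<Rightarrow> ereal) \<Rightarrow> real^'m^'p \<Rightarrow> real^'n^'p \<Rightarrow> real^'p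
    \<Rightarrow> real \<Rightarrow> (real^'m) \<times> (real^'p) \<times> (real^'n) \<Rightarrow> bool" where
  "admm_point f g A B b \<beta> = (\<lambda>(x, y, z). prox_opt f ((*v) A) \<beta> y x \<and>
     prox_opt g ((*v) B) \<beta> (y + \<beta> *\<^sub>R residual A B b (x, y, z)) z)"

definition lagrangian_value :: "(real^'m \<Rightarrow> ereal) \<Rightarrow> (real^'n \<Rightarrow> ereal) \<Rightarrow> real^'m^'p \<Rightarrow> real^'n^'p
    \<Rightarrow> real^'p \<Rightarrow> real \<Rightarrow> (real^'m) \<times> (real^'p) \<times> (real^'n) \<Rightarrow> real" where
  "lagrangian_value f g A B b \<beta> = (\<lambda>(x, y, z). real_of_ereal (aug_lagrangian f g A B b \<beta> x z y))"

text \<open>ADMM is Douglas-Rachford splitting in the variable \<open>s = A x - y / \<beta>\<close>, and its nominal step is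
\<open>s' = s - lam r\<close>. This is the deviation of \<open>s'\<close> from it.\<close>

definition dr_shift :: "real^'m^'p \<Rightarrow> real^'n^'p \<Rightarrow> real^'p \<Rightarrow> real \<Rightarrow> real
    \<Rightarrow> (real^'m) \<times> (real^'p) \<times> (real^'n) \<Rightarrow> (real^'m) \<times> (real^'p) \<times> (real^'n) \<Rightarrow> real^'p" where
  "dr_shift A B b \<beta> lam = (\<lambda>(x, y, z) (x', y', z').
     (A *v x' - (1 / \<beta>) *\<^sub>R y') - (A *v x - (1 / \<beta>) *\<^sub>R y) + lam *\<^sub>R residual A B b (x, y, z))"

lemma admm_point_values:
  assumes "admm_point f g A B b \<beta> (x, y, z)"
  obtains fx gz where "f x = ereal fx" "g z = ereal gz"
    "aug_lagrangian f g A B b \<beta> x z y = ereal (lagrangian_value f g A B b \<beta> (x, y, z))"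
    "lagrangian_value f g A B b \<beta> (x, y, z) = fx + gz +
       (y \<bullet> residual A B b (x, y, z) + \<beta> / 2 * (norm (residual A B b (x, y, z)))\<^sup>2)"
proof -
  have "\<bar>f x\<bar> \<noteq> \<infinity>" "\<bar>g z\<bar> \<noteq> \<infinity>"
    using assms by (simp_all add: admm_point_def prox_opt_def)
  then obtain fx gz where "f x = ereal fx" "g z = ereal gz" by (cases "f x"; cases "g z") auto
  then show ?thesis
    by (intro that) (simp_all add: aug_lagrangian_def lagrangian_value_def residual_def)
qed

lemma ADMM_admm_point:
  assumes "w \<in> ADMM f g A B b \<beta> y' z'" "\<And>x. f x \<noteq> -\<infinity>" "\<And>z. g z \<noteq> -\<infinity>"
  shows "admm_point f g A B b \<beta> w"
  using assms ADMM_optimality(1,2)[of "fst w" "fst (snd w)" "snd (snd w)" f g A B b \<beta> y' z']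
  by (cases w) (auto simp: admm_point_def residual_def)

text \<open>The point of the linesearch: a trial step deviates from the nominal one by a multiple of \<open>\<tau>\<close>.\<close>

lemma dr_shift_trial:
  fixes f :: "real^'m \<Rightarrow> ereal" and g :: "real^'n \<Rightarrow> ereal"
  assumes "w' \<in> ADMM f g A B b \<beta> (trial_y A B b \<beta> lam (x, y, z) d \<tau>) z"
    and "\<And>x. f x \<noteq> -\<infinity>" "\<And>z. g z \<noteq> -\<infinity>" and \<beta>: "\<beta> \<noteq> 0"
  shows "dr_shift A B b \<beta> lam (x, y, z) w' = \<tau> *\<^sub>R (lam *\<^sub>R residual A B b (x, y, z) + d)"
proof -
  obtain x1 y1 z1 where w': "w' = (x1, y1, z1)" by (cases w') auto
  define r where "r = residual A B b (x, y, z)"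
  have y1: "y1 = trial_y A B b \<beta> lam (x, y, z) d \<tau> + \<beta> *\<^sub>R (A *v x1 + B *v z - b)"
    using ADMM_optimality(3) assms(1-3) unfolding w' by blast
  have "trial_y A B b \<beta> lam (x, y, z) d \<tau>
      = y - \<beta> *\<^sub>R (((1 - \<tau>) * (1 - lam)) *\<^sub>R r + \<tau> *\<^sub>R (r + d))"
    unfolding trial_y_def nominal_y_def r_def by (simp add: algebra_simps)
  then have "(1 / \<beta>) *\<^sub>R y1 = (1 / \<beta>) *\<^sub>R y - (((1 - \<tau>) * (1 - lam)) *\<^sub>R r + \<tau> *\<^sub>R (r + d))
      + (A *v x1 + B *v z - b)"
    unfolding y1 using \<beta> by (simp add: scaleR_add_right scaleR_diff_right)
  moreover have "A *v x1 + B *v z - b = A *v x1 - A *v x + r"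
    unfolding r_def residual_def by simp
  ultimately show ?thesis
    unfolding w' dr_shift_def by (simp add: algebra_simps flip: r_def)
qed

lemma nominal_y_eq_trial_y: "nominal_y A B b \<beta> lam w = trial_y A B b \<beta> lam w d 0"
  by (cases w) (simp add: trial_y_def nominal_y_def)

text \<open>The new Lagrangian is bounded above by evaluating the last subproblem at the old \<open>z\<close>. Then \<open>g\<close>
cancels, and what remains is the Bregman distance \<open>D\<close> of the epicomposition of \<open>f\<close> together with
inner products of the steps \<open>w1\<close> of \<open>A x\<close> and \<open>w2\<close> of the scaled gradient at \<open>A x\<close>.\<close>

lemma smooth_progress:
  fixes f :: "real^'m \<Rightarrow> ereal" and g :: "real^'n \<Rightarrow> ereal" and A :: "real^'m^'p"
  assumes par: "0 < \<beta>" "0 < lam" "L < \<beta>" "0 \<le> (2 - lam) / 2 - L / \<beta> * m"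
    and fin: "\<And>s. \<bar>epicomp A f s\<bar> \<noteq> \<infinity>"
    and grad: "\<And>s. GDERIV (\<lambda>s. real_of_ereal (epicomp A f s)) s :> G s"
    and lip: "L-lipschitz_on UNIV G"
    and m: "m = (if convex_fun (epicomp A f) then max (L / \<beta> - lam / 2) 0 else 1)"
    and w: "admm_point f g A B b \<beta> w" and w': "admm_point f g A B b \<beta> w'"
  shows "progress \<beta> lam (L / \<beta>) ((2 - lam) / 2 - L / \<beta> * m) (residual A B b w)
      (dr_shift A B b \<beta> lam w w')
    \<le> lagrangian_value f g A B b \<beta> w - lagrangian_value f g A B b \<beta> w'"
proof -
  obtain x y z where wd: "w = (x, y, z)" by (cases w) auto
  obtain x' y' z' where wd': "w' = (x', y', z')" by (cases w') auto
  define r where "r = residual A B b w"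
  define r' where "r' = residual A B b w'"
  define w1 where "w1 = A *v x' - A *v x"
  define w2 where "w2 = (1 / \<beta>) *\<^sub>R (y - y')"
  have L: "0 \<le> L" using lip by (rule lipschitz_on_nonneg)
  obtain fx gz where v: "f x = ereal fx" "g z = ereal gz" "lagrangian_value f g A B b \<beta> w =
      fx + gz + (y \<bullet> r + \<beta> / 2 * (norm r)\<^sup>2)"
    using admm_point_values w unfolding wd r_def by metis
  obtain fx' gz' where v': "f x' = ereal fx'" "g z' = ereal gz'" "lagrangian_value f g A B b \<beta> w' =
      fx' + gz' + (y' \<bullet> r' + \<beta> / 2 * (norm r')\<^sup>2)"
    using admm_point_values w' unfolding wd' r'_def by metis
  have opt: "prox_opt f ((*v) A) \<beta> y x" "prox_opt f ((*v) A) \<beta> y' x'"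
    using w w' unfolding wd wd' admm_point_def by auto
  have y: "y = - G (A *v x)" "y' = - G (A *v x')"
    using opt by (auto intro!: prox_opt_gradient[OF fin grad lip] prox_opt_epicomp)
  have \<phi>: "real_of_ereal (epicomp A f (A *v x)) = fx" "real_of_ereal (epicomp A f (A *v x')) = fx'"
    using prox_opt_epicomp(1)[OF opt(1)] prox_opt_epicomp(1)[OF opt(2)] v v' by auto
  define D where "D = fx - fx' - G (A *v x') \<bullet> (A *v x - A *v x')"
  have "norm (y - y') \<le> L * norm w1"
    using lipschitz_onD[OF lip, of "A *v x'" "A *v x"] unfolding y w1_def
    by (simp add: dist_norm)
  moreover have "norm w2 = norm (y - y') / \<beta>" unfolding w2_def using par by simp
  ultimately have w2: "norm w2 \<le> L / \<beta> * norm w1" using par by (simp add: field_simps)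
  have D_bound: "\<beta> * ((norm w2)\<^sup>2 - L / \<beta> * m * (norm w1)\<^sup>2) \<le> lam * D"
  proof (cases "convex_fun (epicomp A f)")
    case True
    have "\<beta> / 2 * (norm w2)\<^sup>2 = (norm (G (A *v x) - G (A *v x')))\<^sup>2 / 2 / \<beta>"
      unfolding w2_def y using par
      by (simp add: power_divide power2_eq_square norm_minus_commute)
    also have "\<dots> \<le> L * D / \<beta>"
      using convex_lipschitz_gradient_cocoercive(2)[OF fin grad lip True, of "A *v x" "A *v x'"] par
      unfolding D_def \<phi> by (intro divide_right_mono) auto
    finally show ?thesis
      using convex_lipschitz_gradient_cocoercive(1)[OF fin grad lip True, of "A *v x" "A *v x'"] par L w2 m True
      by (intro bregman_bound_convex) (auto simp: D_def \<phi>)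
  next
    case False
    have "0 \<le> (2 - lam) / 2 - L / \<beta> * 1" using par(4) m False by simp
    \<comment> \<open>For \<open>m = 1\<close> nonnegativity of the constant is the bound \<open>2 L / (2 - lam) \<le> \<beta>\<close>.\<close>
    then have "L / \<beta> + lam / 2 \<le> 1" by (simp add: diff_divide_distrib)
    moreover have "- (\<beta> * (L / \<beta>) / 2 * (norm w1)\<^sup>2) \<le> D"
      using lipschitz_gradient_lower_bound[OF grad lip, where u="A *v x'" and w="A *v x"] par
      unfolding D_def w1_def \<phi> by (simp add: norm_minus_commute)
    ultimately show ?thesis
      using bregman_bound_weakly_convex[of \<beta> lam "L / \<beta>" "norm w2" "norm w1" D] par L w2 m False by simp
  qed
  have "prox_opt g ((*v) B) \<beta> (y' + \<beta> *\<^sub>R r') z'"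
    using w' unfolding wd' admm_point_def r'_def by simp
  then have "g z' \<le> g z + ereal ((y' + \<beta> *\<^sub>R r') \<bullet> (B *v z - B *v z') + \<beta> / 2 * (norm (B *v z - B *v z'))\<^sup>2)"
    unfolding prox_opt_def by blast
  moreover have r'_eq: "r' = B *v z' + (A *v x' - b)"
    unfolding r'_def wd' residual_def by simp
  moreover have r_eq: "r + w1 = B *v z + (A *v x' - b)"
    unfolding r_def wd residual_def w1_def by simp
  ultimately have "gz' + (y' \<bullet> r' + \<beta> / 2 * (norm r')\<^sup>2)
      \<le> gz + (y' \<bullet> (r + w1) + \<beta> / 2 * (norm (r + w1))\<^sup>2)"
    unfolding v v' using quadratic_increment[of y' "B *v z" "A *v x' - b" \<beta> "B *v z'"] by simp
  moreover have "D + \<beta> * ((w2 - w1) \<bullet> r) - \<beta> / 2 * (norm w1)\<^sup>2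
      = fx + (y \<bullet> r + \<beta> / 2 * (norm r)\<^sup>2) - fx' - (y' \<bullet> (r + w1) + \<beta> / 2 * (norm (r + w1))\<^sup>2)"
  proof -
    have "\<beta> * (w2 \<bullet> r) = y \<bullet> r - y' \<bullet> r"
      unfolding w2_def using par by (simp add: inner_diff_left)
    moreover have "D = fx - fx' - y' \<bullet> w1"
      unfolding D_def y w1_def by (simp add: inner_diff_right)
    ultimately show ?thesis
      unfolding power2_norm_eq_inner
      by (simp add: inner_add_left inner_add_right inner_diff_left inner_commute algebra_simps)
  qed
  ultimately have gain: "D + \<beta> * ((w2 - w1) \<bullet> r) - \<beta> / 2 * (norm w1)\<^sup>2
      \<le> lagrangian_value f g A B b \<beta> w - lagrangian_value f g A B b \<beta> w'"
    unfolding v v' by linarith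
  have sum: "w1 + w2 = dr_shift A B b \<beta> lam w w' - lam *\<^sub>R r"
    unfolding dr_shift_def r_def wd wd' w1_def w2_def by (simp add: algebra_simps)
  show ?thesis
    unfolding r_def[symmetric]
    using par L by (intro progress_le_gain[OF _ _ _ _ _ sum w2 D_bound gain]) auto
qed

text \<open>The dual counterpart, with the Lagrangian increasing. Now the new Lagrangian is bounded below,
by the subgradient inequality of the epicomposition of \<open>g\<close> at the old \<open>B z\<close>; this bound depends
on \<open>z'\<close> only through a square. Strong convexity of \<open>f\<close> makes the step \<open>w2\<close> of \<open>A x\<close> small
against the scaled step \<open>w1\<close> of the multiplier.\<close>

lemma strongly_convex_progress:
  fixes f :: "real^'m \<Rightarrow> ereal" and g :: "real^'n \<Rightarrow> ereal" and A :: "real^'m^'p"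
  assumes par: "0 < \<beta>" "0 < lam" "\<beta> * (op_norm A)\<^sup>2 < \<mu>"
    and conv: "convex_fun (\<lambda>x. f x - ereal (\<mu> / 2 * (norm x)\<^sup>2))" "convex_fun (epicomp B g)"
    and m: "max (\<beta> * (op_norm A)\<^sup>2 / \<mu> - lam / 2) 0 \<le> m" "0 \<le> (2 - lam) / 2 - \<beta> * (op_norm A)\<^sup>2 / \<mu> * m"
    and w: "admm_point f g A B b \<beta> w" and w': "admm_point f g A B b \<beta> w'"
  shows "progress \<beta> lam (\<beta> * (op_norm A)\<^sup>2 / \<mu>) ((2 - lam) / 2 - \<beta> * (op_norm A)\<^sup>2 / \<mu> * m)
      (residual A B b w) (dr_shift A B b \<beta> lam w w')
    \<le> lagrangian_value f g A B b \<beta> w' - lagrangian_value f g A B b \<beta> w"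
proof -
  define \<alpha> where "\<alpha> = \<beta> * (op_norm A)\<^sup>2 / \<mu>"
  have \<mu>: "0 < \<mu>" using par by (smt (verit) mult_nonneg_nonneg zero_le_power2)
  then have \<alpha>: "0 \<le> \<alpha>" "\<alpha> < 1" using par unfolding \<alpha>_def by (auto simp: field_simps)
  obtain x y z where wd: "w = (x, y, z)" by (cases w) auto
  obtain x' y' z' where wd': "w' = (x', y', z')" by (cases w') auto
  define r where "r = residual A B b w"
  define r' where "r' = residual A B b w'"
  define w1 where "w1 = (1 / \<beta>) *\<^sub>R (y - y')"
  define w2 where "w2 = A *v x' - A *v x"
  obtain fx gz where v: "f x = ereal fx" "g z = ereal gz" "lagrangian_value f g A B b \<beta> w =
      fx + gz + (y \<bullet> r + \<beta> / 2 * (norm r)\<^sup>2)"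
    using admm_point_values w unfolding wd r_def by metis
  obtain fx' gz' where v': "f x' = ereal fx'" "g z' = ereal gz'" "lagrangian_value f g A B b \<beta> w' =
      fx' + gz' + (y' \<bullet> r' + \<beta> / 2 * (norm r')\<^sup>2)"
    using admm_point_values w' unfolding wd' r'_def by metis
  have opt: "prox_opt f ((*v) A) \<beta> y x" "prox_opt f ((*v) A) \<beta> y' x'"
    "prox_opt g ((*v) B) \<beta> (y + \<beta> *\<^sub>R r) z" "prox_opt g ((*v) B) \<beta> (y' + \<beta> *\<^sub>R r') z'"
    using w w' unfolding wd wd' r_def r'_def admm_point_def by auto
  define D where "D = fx' - fx + y \<bullet> w2"
  have D: "\<mu> / 2 * (norm (x' - x))\<^sup>2 \<le> D"
    using convex_prox_opt_subgradient[OF matrix_vector_mul_linear conv(1) opt(1), of x']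
    unfolding D_def w2_def v v' by simp
  have "\<mu> / 2 * (norm (x' - x))\<^sup>2 \<le> fx - fx' - y' \<bullet> w2"
    using convex_prox_opt_subgradient[OF matrix_vector_mul_linear conv(1) opt(2), of x]
    unfolding w2_def v v' by (simp add: norm_minus_commute inner_diff_right)
  with D have "\<mu> * (norm (x' - x))\<^sup>2 \<le> (y - y') \<bullet> w2"
    unfolding D_def by (simp add: inner_diff_left)
  also have "\<dots> \<le> \<beta> * (norm w1 * norm w2)"
    using norm_cauchy_schwarz[of "y - y'" w2] par unfolding w1_def by simp
  finally have mono: "\<mu> * (norm (x' - x))\<^sup>2 \<le> \<beta> * (norm w1 * norm w2)" .
  have "norm w2 \<le> op_norm A * norm (x' - x)"
    unfolding w2_def using norm_mult_le[of A "x' - x"] by (simp add: matrix_vector_mult_diff_distrib)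
  then have w2_le: "(norm w2)\<^sup>2 \<le> (op_norm A)\<^sup>2 * (norm (x' - x))\<^sup>2"
    using power_mono[OF _ norm_ge_zero, of w2 "op_norm A * norm (x' - x)" 2]
    by (simp add: power_mult_distrib)
  then have "\<mu> * (norm w2)\<^sup>2 \<le> (op_norm A)\<^sup>2 * (\<mu> * (norm (x' - x))\<^sup>2)"
    using \<mu> by (simp add: mult.left_commute)
  also have "\<dots> \<le> (op_norm A)\<^sup>2 * (\<beta> * (norm w1 * norm w2))"
    using mono by (intro mult_left_mono) auto
  finally have "norm w2 * norm w2 \<le> \<alpha> * norm w1 * norm w2"
    unfolding \<alpha>_def using \<mu> by (simp add: field_simps power2_eq_square)
  then have w2: "norm w2 \<le> \<alpha> * norm w1"
    using \<alpha>(1) by (cases "norm w2 = 0") (auto simp: mult_le_cancel_right)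
  have D_bound: "\<beta> * ((norm w2)\<^sup>2 - \<alpha> * m * (norm w1)\<^sup>2) \<le> lam * D"
  proof (rule bregman_bound_convex)
    show "0 \<le> D" using D \<mu> by (smt (verit) mult_nonneg_nonneg zero_le_power2 divide_nonneg_nonneg)
    have "\<beta> / 2 * (norm w2)\<^sup>2 \<le> \<beta> / 2 * ((op_norm A)\<^sup>2 * (norm (x' - x))\<^sup>2)"
      using w2_le par by (intro mult_left_mono) auto
    also have "\<dots> = \<alpha> * (\<mu> / 2 * (norm (x' - x))\<^sup>2)" unfolding \<alpha>_def using \<mu> by simp
    also have "\<dots> \<le> \<alpha> * D" using D \<alpha> by (intro mult_left_mono) auto
    finally show "\<beta> / 2 * (norm w2)\<^sup>2 \<le> \<alpha> * D" .
  qed (use par \<alpha> w2 m in \<open>auto simp: \<alpha>_def\<close>)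
  have conv_g: "convex_fun (\<lambda>s. epicomp B g s - ereal (0 / 2 * (norm s)\<^sup>2))" using conv(2) by simp
  have g: "gz \<le> gz' + (y + \<beta> *\<^sub>R r) \<bullet> (B *v z' - B *v z)"
    using convex_prox_opt_subgradient[OF linear_ident conv_g prox_opt_epicomp(2)[OF opt(3)], of "B *v z'"]
    unfolding prox_opt_epicomp(1)[OF opt(3)] prox_opt_epicomp(1)[OF opt(4)] v v' by simp
  have gain: "D + \<beta> * ((w2 - w1) \<bullet> r) - \<beta> / 2 * (norm w1)\<^sup>2
      \<le> lagrangian_value f g A B b \<beta> w' - lagrangian_value f g A B b \<beta> w"
  proof -
    have Bz: "B *v z' - B *v z = r' - r - w2"
      unfolding r_def r'_def wd wd' residual_def w2_def by simp
    have y': "y' = y - \<beta> *\<^sub>R w1" unfolding w1_def using par by simp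
    \<comment> \<open>The square vanishes at the minimizing \<open>r' = r + w1\<close> of the lower bound.\<close>
    have "(fx' - (y + \<beta> *\<^sub>R r) \<bullet> (r' - r - w2) + (y' \<bullet> r' + \<beta> / 2 * (norm r')\<^sup>2))
        - (fx + (y \<bullet> r + \<beta> / 2 * (norm r)\<^sup>2))
        - (D + \<beta> * ((w2 - w1) \<bullet> r) - \<beta> / 2 * (norm w1)\<^sup>2) = \<beta> / 2 * (norm (r' - r - w1))\<^sup>2"
      unfolding y' D_def power2_norm_eq_inner
      by (simp add: inner_add_left inner_add_right inner_diff_left inner_diff_right inner_commute algebra_simps)
    moreover have "0 \<le> \<beta> / 2 * (norm (r' - r - w1))\<^sup>2" using par by simp
    ultimately show ?thesis using g unfolding Bz v v' by linarith
  qed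
  have sum: "w1 + w2 = dr_shift A B b \<beta> lam w w' - lam *\<^sub>R r"
    unfolding dr_shift_def r_def wd wd' w1_def w2_def by (simp add: algebra_simps)
  show ?thesis
    unfolding r_def[symmetric] \<alpha>_def[symmetric]
    using par \<alpha> m by (intro progress_le_gain[OF _ _ _ _ _ sum w2 D_bound gain]) (auto simp: \<alpha>_def)
qed

section \<open>The Lagrangian and the optimal value\<close>

text \<open>The quadratic upper bound at \<open>A x\<close> controls the epicomposition of \<open>f\<close> at \<open>b - B z\<close>, the argument
that is feasible together with \<open>z\<close>; as \<open>L < \<beta>\<close>, the penalty covers its quadratic term.\<close>

lemma smooth_min_Phi_le:
  fixes f :: "real^'m \<Rightarrow> ereal" and g :: "real^'n \<Rightarrow> ereal" and A :: "real^'m^'p"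
  assumes par: "L < \<beta>"
    and fin: "\<And>s. \<bar>epicomp A f s\<bar> \<noteq> \<infinity>"
    and grad: "\<And>s. GDERIV (\<lambda>s. real_of_ereal (epicomp A f s)) s :> G s"
    and lip: "L-lipschitz_on UNIV G"
    and w: "admm_point f g A B b \<beta> w"
  shows "min_Phi f g A B b \<le> ereal (lagrangian_value f g A B b \<beta> w)"
proof -
  obtain x y z where wd: "w = (x, y, z)" by (cases w) auto
  define r where "r = residual A B b w"
  obtain fx gz where v: "f x = ereal fx" "g z = ereal gz" "lagrangian_value f g A B b \<beta> w =
      fx + gz + (y \<bullet> r + \<beta> / 2 * (norm r)\<^sup>2)"
    using admm_point_values w unfolding wd r_def by metis
  have opt: "prox_opt f ((*v) A) \<beta> y x"
    using w unfolding wd admm_point_def by auto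
  have y: "y = - G (A *v x)"
    using opt by (auto intro!: prox_opt_gradient[OF fin grad lip] prox_opt_epicomp)
  have \<phi>: "real_of_ereal (epicomp A f (A *v x)) = fx"
    using prox_opt_epicomp(1)[OF opt] v by auto
  obtain a where a: "epicomp A f (b - B *v z) = ereal a"
    using fin[of "b - B *v z"] by (cases "epicomp A f (b - B *v z)") auto
  have "min_Phi f g A B b - g z \<le> epicomp A f (b - B *v z)"
    unfolding epicomp_def
  proof (rule INF_greatest)
    fix x' assume "x' \<in> {x'. A *v x' = b - B *v z}"
    then have "Phi f g A B b (x', z) = f x' + g z" by (simp add: Phi_def)
    then have "min_Phi f g A B b \<le> f x' + g z"
      unfolding min_Phi_def by (metis INF_lower UNIV_I)
    then show "min_Phi f g A B b - g z \<le> f x'" unfolding v by (simp add: ereal_minus_le_iff add.commute)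
  qed
  then have M: "min_Phi f g A B b \<le> ereal (a + gz)"
    unfolding a v by (cases "min_Phi f g A B b") auto
  have diff: "b - B *v z - A *v x = - r" unfolding r_def wd residual_def by simp
  have "a \<le> fx + y \<bullet> r + L / 2 * (norm r)\<^sup>2"
    using lipschitz_gradient_upper_bound[OF grad lip, of "b - B *v z" "A *v x"]
    unfolding \<phi> a y diff by simp
  also have "\<dots> \<le> fx + y \<bullet> r + \<beta> / 2 * (norm r)\<^sup>2"
    using par by (intro add_left_mono mult_right_mono) auto
  finally show ?thesis using M unfolding v by (simp add: order_trans)
qed

text \<open>Weak duality: the two subgradient inequalities at the ADMM point, added at a feasible pair. They
leave a term \<open>\<beta> / 2 \<parallel>A x' - A x\<parallel>\<^sup>2\<close>, which the strong convexity of \<open>f\<close> absorbs.\<close>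

lemma strongly_convex_le_min_Phi:
  fixes f :: "real^'m \<Rightarrow> ereal" and g :: "real^'n \<Rightarrow> ereal" and A :: "real^'m^'p"
  assumes par: "0 < \<beta>" "\<beta> * (op_norm A)\<^sup>2 < \<mu>"
    and conv: "convex_fun (\<lambda>x. f x - ereal (\<mu> / 2 * (norm x)\<^sup>2))" "convex_fun (epicomp B g)"
    and w: "admm_point f g A B b \<beta> w"
  shows "ereal (lagrangian_value f g A B b \<beta> w) \<le> min_Phi f g A B b"
  unfolding min_Phi_def
proof (rule INF_greatest)
  fix w' :: "(real^'m) \<times> (real^'n)"
  obtain x y z where wd: "w = (x, y, z)" by (cases w) auto
  obtain x' z' where wd': "w' = (x', z')" by (cases w') auto
  define r where "r = residual A B b w"
  obtain fx gz where v: "f x = ereal fx" "g z = ereal gz" "lagrangian_value f g A B b \<beta> w =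
      fx + gz + (y \<bullet> r + \<beta> / 2 * (norm r)\<^sup>2)"
    using admm_point_values w unfolding wd r_def by metis
  have opt: "prox_opt f ((*v) A) \<beta> y x" "prox_opt g ((*v) B) \<beta> (y + \<beta> *\<^sub>R r) z"
    using w unfolding wd r_def admm_point_def by auto
  show "ereal (lagrangian_value f g A B b \<beta> w) \<le> Phi f g A B b w'"
  proof (cases "A *v x' + B *v z' = b \<and> f x' \<noteq> \<infinity> \<and> g z' \<noteq> \<infinity>")
    case False
    then show ?thesis
      using prox_opt_not_MInf[OF opt(1), of x'] prox_opt_not_MInf[OF opt(2), of z']
      unfolding wd' Phi_def by (cases "f x'"; cases "g z'") auto
  next
    case True
    then obtain fx' gz' where v': "f x' = ereal fx'" "g z' = ereal gz'"
      using prox_opt_not_MInf[OF opt(1), of x'] prox_opt_not_MInf[OF opt(2), of z']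
      by (cases "f x'"; cases "g z'") auto
    define \<delta> where "\<delta> = A *v x' - A *v x"
    have f: "fx \<le> fx' + y \<bullet> \<delta> - \<mu> / 2 * (norm (x' - x))\<^sup>2"
      using convex_prox_opt_subgradient[OF matrix_vector_mul_linear conv(1) opt(1), of x']
      unfolding \<delta>_def v v' by simp
    have conv_g: "convex_fun (\<lambda>s. epicomp B g s - ereal (0 / 2 * (norm s)\<^sup>2))" using conv(2) by simp
    have "epicomp B g (B *v z') \<le> g z'" unfolding epicomp_def by (rule INF_lower) simp
    then have "g z \<le> g z' + ereal ((y + \<beta> *\<^sub>R r) \<bullet> (B *v z' - B *v z))"
      using convex_prox_opt_subgradient[OF linear_ident conv_g prox_opt_epicomp(2)[OF opt(2)], of "B *v z'"]
      unfolding prox_opt_epicomp(1)[OF opt(2)]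
      by (auto intro: order_trans add_right_mono)
    moreover have "B *v z' - B *v z = - (r + \<delta>)"
      using True unfolding r_def \<delta>_def wd residual_def by (simp add: algebra_simps)
    ultimately have g: "gz \<le> gz' - (y + \<beta> *\<^sub>R r) \<bullet> (r + \<delta>)"
      unfolding v v' by (simp add: inner_diff_right inner_add_right)
    have "norm \<delta> \<le> op_norm A * norm (x' - x)"
      unfolding \<delta>_def using norm_mult_le[of A "x' - x"] by (simp add: matrix_vector_mult_diff_distrib)
    then have "(norm \<delta>)\<^sup>2 \<le> (op_norm A)\<^sup>2 * (norm (x' - x))\<^sup>2"
      using power_mono[OF _ norm_ge_zero, of \<delta> "op_norm A * norm (x' - x)" 2]
      by (simp add: power_mult_distrib)
    then have "\<beta> * (norm \<delta>)\<^sup>2 \<le> \<beta> * (op_norm A)\<^sup>2 * (norm (x' - x))\<^sup>2"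
      using par by simp
    also have "\<dots> \<le> \<mu> * (norm (x' - x))\<^sup>2" using par by (intro mult_right_mono) auto
    finally have \<delta>: "\<beta> / 2 * (norm \<delta>)\<^sup>2 \<le> \<mu> / 2 * (norm (x' - x))\<^sup>2" by simp
    have "y \<bullet> \<delta> - (y + \<beta> *\<^sub>R r) \<bullet> (r + \<delta>) + (y \<bullet> r + \<beta> / 2 * (norm r)\<^sup>2)
        = \<beta> / 2 * (norm \<delta>)\<^sup>2 - \<beta> / 2 * (norm (r + \<delta>))\<^sup>2"
      unfolding power2_norm_eq_inner
      by (simp add: inner_add_left inner_add_right inner_commute algebra_simps)
    moreover have "0 \<le> \<beta> / 2 * (norm (r + \<delta>))\<^sup>2" using par by simp
    ultimately have "lagrangian_value f g A B b \<beta> w \<le> fx' + gz'"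
      using f g \<delta> unfolding v by linarith
    then show ?thesis using True v' unfolding wd' Phi_def by simp
  qed
qed

section \<open>Runs of the linesearch algorithm\<close>

lemma progress_tendsto:
  "(e \<longlongrightarrow> 0) F \<Longrightarrow> ((\<lambda>i. progress \<beta> lam \<alpha> \<kappa> r (e i)) \<longlongrightarrow> progress \<beta> lam \<alpha> \<kappa> r 0) F"
  unfolding progress_def divide_inverse by (intro tendsto_eq_intros) (auto)

text \<open>What the analysis of runs needs, common to both cases: along ADMM points the signed Lagrangian is
bounded below and gains at least \<open>progress\<close>, whose value at zero deviation is more than the
linesearch condition asks for. The sign \<open>sg\<close> turns the ascent of the strongly convex case into
descent.\<close>

locale linesearch =
  fixes f :: "real^'m \<Rightarrow> ereal" and g :: "real^'n \<Rightarrow> ereal"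
    and A :: "real^'m^'p" and B :: "real^'n^'p" and b :: "real^'p"
    and \<beta> sg c lam \<epsilon> \<alpha> \<kappa> M :: real and imax :: enat
  assumes pos: "0 < \<beta>" "0 < c" "0 < lam" "0 < \<epsilon>"
    and f_MInf: "f x \<noteq> -\<infinity>" and g_MInf: "g z \<noteq> -\<infinity>"
    and c_less: "c < lam / (1 + \<alpha>)\<^sup>2 * \<kappa>"
    and bound: "admm_point f g A B b \<beta> w \<Longrightarrow> sg * M \<le> sg * lagrangian_value f g A B b \<beta> w"
    and gain: "admm_point f g A B b \<beta> w \<Longrightarrow> admm_point f g A B b \<beta> w' \<Longrightarrow>
      progress \<beta> lam \<alpha> \<kappa> (residual A B b w) (dr_shift A B b \<beta> lam w w')
        \<le> sg * lagrangian_value f g A B b \<beta> w - sg * lagrangian_value f g A B b \<beta> w'"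
begin

abbreviation point where "point \<equiv> admm_point f g A B b \<beta>"
abbreviation res where "res \<equiv> residual A B b"
abbreviation val where "val w \<equiv> sg * lagrangian_value f g A B b \<beta> w"
abbreviation outputs where "outputs \<equiv> ADMM f g A B b \<beta>"
abbreviation step where "step \<equiv> ls_step f g A B b \<beta> sg c lam \<epsilon> imax"

lemma output_point: "w \<in> outputs y z \<Longrightarrow> point w"
  by (rule ADMM_admm_point[OF _ f_MInf g_MInf])

lemma accepts_iff:
  assumes "point w" "point w'"
  shows "accepts f g A B b \<beta> sg c w w' \<longleftrightarrow> val w' \<le> val w - \<beta> * c * (norm (res w))\<^sup>2"
proof -
  obtain x y z x' y' z' where w: "w = (x, y, z)" "w' = (x', y', z')" by (cases w; cases w') auto
  then have "aug_lagrangian f g A B b \<beta> x z y = ereal (lagrangian_value f g A B b \<beta> w)"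
    "aug_lagrangian f g A B b \<beta> x' z' y' = ereal (lagrangian_value f g A B b \<beta> w')"
    using assms admm_point_values by metis+
  then show ?thesis unfolding accepts_def w by simp
qed

text \<open>The fallback step meets the linesearch condition as well, so every iteration satisfies it.\<close>

lemma nominal_decrease:
  assumes "point (x, y, z)" "w' \<in> outputs (nominal_y A B b \<beta> lam (x, y, z)) z"
  shows "val w' \<le> val (x, y, z) - \<beta> * c * (norm (res (x, y, z)))\<^sup>2"
proof -
  have "w' \<in> outputs (trial_y A B b \<beta> lam (x, y, z) 0 0) z"
    using assms(2) by (simp only: nominal_y_eq_trial_y[symmetric])
  from dr_shift_trial[OF this f_MInf g_MInf] have "dr_shift A B b \<beta> lam (x, y, z) w' = 0"
    using pos by simp
  then have "\<beta> * (lam / (1 + \<alpha>)\<^sup>2 * \<kappa>) * (norm (res (x, y, z)))\<^sup>2 \<le> val (x, y, z) - val w'"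
    using gain[OF assms(1) output_point[OF assms(2)]] pos by (simp add: progress_unperturbed)
  moreover have "\<beta> * c * (norm (res (x, y, z)))\<^sup>2
      \<le> \<beta> * (lam / (1 + \<alpha>)\<^sup>2 * \<kappa>) * (norm (res (x, y, z)))\<^sup>2"
    using pos c_less by (intro mult_right_mono mult_left_mono) auto
  ultimately show ?thesis by simp
qed

text \<open>Halving \<open>\<tau>\<close> sends the deviation to zero, and \<open>progress\<close> is continuous there. The threshold does
not depend on which outputs the ADMM steps select.\<close>

lemma eventually_accepts:
  assumes w: "point (x, y, z)" and r: "res (x, y, z) \<noteq> 0"
  shows "\<forall>\<^sub>F i in sequentially. \<forall>w' \<in> outputs (trial_y A B b \<beta> lam (x, y, z) d (1 / 2 ^ i)) z.
    accepts f g A B b \<beta> sg c (x, y, z) w'"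
proof -
  let ?r = "res (x, y, z)"
  let ?e = "\<lambda>i::nat. (1 / 2 ^ i) *\<^sub>R (lam *\<^sub>R ?r + d)"
  have "(\<lambda>i. (1 / 2) ^ i :: real) \<longlonglongrightarrow> 0" by (rule LIMSEQ_realpow_zero) auto
  from tendsto_scaleR[OF this tendsto_const[of "lam *\<^sub>R ?r + d"]] have "?e \<longlonglongrightarrow> 0"
    by (simp add: power_divide)
  then have "(\<lambda>i. progress \<beta> lam \<alpha> \<kappa> ?r (?e i)) \<longlonglongrightarrow> progress \<beta> lam \<alpha> \<kappa> ?r 0"
    by (rule progress_tendsto)
  moreover have "\<beta> * c * (norm ?r)\<^sup>2 < progress \<beta> lam \<alpha> \<kappa> ?r 0"
  proof -
    have "\<beta> * c * (norm ?r)\<^sup>2 < \<beta> * (lam / (1 + \<alpha>)\<^sup>2 * \<kappa>) * (norm ?r)\<^sup>2"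
      using pos c_less r by (intro mult_strict_right_mono mult_strict_left_mono) auto
    then show ?thesis using pos by (simp only: progress_unperturbed less_imp_neq[symmetric] simp_thms)
  qed
  ultimately have "\<forall>\<^sub>F i in sequentially. \<beta> * c * (norm ?r)\<^sup>2 < progress \<beta> lam \<alpha> \<kappa> ?r (?e i)"
    by (rule order_tendstoD(1))
  then show ?thesis
  proof (rule eventually_mono, intro ballI)
    fix i w'
    assume less: "\<beta> * c * (norm ?r)\<^sup>2 < progress \<beta> lam \<alpha> \<kappa> ?r (?e i)"
      and mem: "w' \<in> outputs (trial_y A B b \<beta> lam (x, y, z) d (1 / 2 ^ i)) z"
    have "dr_shift A B b \<beta> lam (x, y, z) w' = ?e i"
      using dr_shift_trial[OF mem f_MInf g_MInf] pos by simp
    then show "accepts f g A B b \<beta> sg c (x, y, z) w'"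
      using less gain[OF w output_point[OF mem]] unfolding accepts_iff[OF w output_point[OF mem]]
      by simp
  qed
qed

text \<open>The amount by which an iteration that does not stop lowers the signed Lagrangian, since then
\<open>\<parallel>r\<parallel> > \<epsilon> / \<beta>\<close>.\<close>

definition decrement :: real where "decrement = c * \<epsilon>\<^sup>2 / \<beta>"

lemma decrement_pos: "0 < decrement"
  unfolding decrement_def using pos by simp

lemma decrement_le:
  assumes "\<not> \<beta> * norm (res w) \<le> \<epsilon>" shows "decrement \<le> \<beta> * c * (norm (res w))\<^sup>2"
proof -
  have "\<epsilon>\<^sup>2 \<le> (\<beta> * norm (res w))\<^sup>2" using assms pos by (intro power_mono) auto
  then have "c * \<epsilon>\<^sup>2 / \<beta> \<le> c * (\<beta> * norm (res w))\<^sup>2 / \<beta>"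
    using pos by (intro divide_right_mono mult_left_mono) auto
  then show ?thesis unfolding decrement_def using pos by (simp add: power2_eq_square mult_ac)
qed

text \<open>Here \<open>v\<close> is the signed Lagrangian at the initial point. The closed form of \<open>\<tau>\<close> connects the
backtracking counter with \<open>eventually_accepts\<close>.\<close>

fun invariant :: "real \<Rightarrow> ('m, 'p, 'n) ls_state \<Rightarrow> bool" where
  "invariant v (Check k w) \<longleftrightarrow> point w \<and> val w \<le> v - real k * decrement"
| "invariant v (Trial k w d \<tau> i) \<longleftrightarrow> point w \<and> val w \<le> v - real k * decrement \<and>
     \<not> \<beta> * norm (res w) \<le> \<epsilon> \<and> \<tau> = 1 / 2 ^ i"
| "invariant v (Stopped k w) \<longleftrightarrow> point w \<and> val w \<le> v - real k * decrement \<and>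
     \<beta> * norm (res w) \<le> \<epsilon>"

fun iteration :: "('m, 'p, 'n) ls_state \<Rightarrow> nat" where
  "iteration (Check k w) = k"
| "iteration (Trial k w d \<tau> i) = k"
| "iteration (Stopped k w) = k"

lemma step_invariant:
  assumes "step s s'" "invariant v s"
  shows "invariant v s'"
  using assms
proof cases
  case (accept w' x y z d \<tau> k i)
  have p: "point w'" "point (x, y, z)" and t: "\<not> \<beta> * norm (res (x, y, z)) \<le> \<epsilon>"
    and v: "val (x, y, z) \<le> v - real k * decrement"
    using accept assms(2) output_point by auto
  have "val w' \<le> val (x, y, z) - \<beta> * c * (norm (res (x, y, z)))\<^sup>2"
    using accept accepts_iff p by blast
  then show ?thesis using p v decrement_le[OF t] unfolding accept by (simp add: algebra_simps)
next
  case (fallback w' x y z d \<tau> i w'' k)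
  have p: "point w''" "point (x, y, z)" and t: "\<not> \<beta> * norm (res (x, y, z)) \<le> \<epsilon>"
    and v: "val (x, y, z) \<le> v - real k * decrement"
    using fallback assms(2) output_point by auto
  have "val w'' \<le> val (x, y, z) - \<beta> * c * (norm (res (x, y, z)))\<^sup>2"
    using nominal_decrease p fallback by blast
  then show ?thesis using p v decrement_le[OF t] unfolding fallback by (simp add: algebra_simps)
next
  case (stop w k)
  then show ?thesis using assms(2) by (simp only: invariant.simps)
next
  case (select_direction w k d)
  then show ?thesis using assms(2) by (simp only: invariant.simps) simp
next
  case (backtrack w' x y z d \<tau> i k)
  then show ?thesis using assms(2) by (simp only: invariant.simps) simp
qed

lemma step_iteration: "step s s' \<Longrightarrow> iteration s \<le> iteration s'"
  by (erule ls_step.cases) simp_all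

context
  fixes w_in w0 :: "(real^'m) \<times> (real^'p) \<times> (real^'n)" and \<sigma> :: "nat \<Rightarrow> ('m, 'p, 'n) ls_state"
  assumes run: "ls_run f g A B b \<beta> sg c lam \<epsilon> imax w_in w0 \<sigma>"
begin

lemma run_start: "point w0" "\<sigma> 0 = Check 0 w0"
proof -
  show "point w0"
    by (rule output_point) (rule conjunct1[OF run[unfolded ls_run_def]])
  show "\<sigma> 0 = Check 0 w0"
    by (rule conjunct1[OF conjunct2[OF run[unfolded ls_run_def]]])
qed

lemma run_step: "step (\<sigma> t) (\<sigma> (Suc t)) \<or> (\<exists>k w. \<sigma> t = Stopped k w \<and> \<sigma> (Suc t) = Stopped k w)"
  using conjunct2[OF conjunct2[OF run[unfolded ls_run_def]]] by (rule spec)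

lemma run_invariant: "invariant (val w0) (\<sigma> t)"
proof (induction t)
  case 0
  show ?case using run_start by simp
next
  case (Suc t)
  show ?case
    using run_step[of t]
  proof
    assume "step (\<sigma> t) (\<sigma> (Suc t))"
    then show ?thesis using Suc.IH by (rule step_invariant)
  next
    assume "\<exists>k w. \<sigma> t = Stopped k w \<and> \<sigma> (Suc t) = Stopped k w"
    then show ?thesis using Suc.IH by metis
  qed
qed

lemma run_iteration_mono: "t \<le> t' \<Longrightarrow> iteration (\<sigma> t) \<le> iteration (\<sigma> t')"
proof (rule lift_Suc_mono_le[of "\<lambda>t. iteration (\<sigma> t)"])
  show "iteration (\<sigma> t) \<le> iteration (\<sigma> (Suc t))" for t
    using run_step[of t] step_iteration by (metis order_refl)
qed

text \<open>Endless backtracking would reject outputs for arbitrarily small \<open>\<tau>\<close>.\<close>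

lemma Trial_terminates:
  assumes "\<sigma> t = Trial k w d \<tau> i"
  obtains t' w' where "t' > t" "\<sigma> t' = Check (Suc k) w'"
proof (rule ccontr)
  assume not_thesis: "\<not> thesis"
  have no: "\<sigma> t' \<noteq> Check (Suc k) w'" if "t' > t" for t' w'
    using that not_thesis \<open>\<And>t' w'. t < t' \<Longrightarrow> \<sigma> t' = Check (Suc k) w' \<Longrightarrow> thesis\<close> by metis
  \<comment> \<open>Without a next iteration, the only transition left is backtracking.\<close>
  have all: "\<sigma> (t + j) = Trial k w d (\<tau> / 2 ^ j) (i + j)" for j
  proof (induction j)
    case 0
    then show ?case using assms by simp
  next
    case (Suc j)
    from run_step[of "t + j"] have "step (Trial k w d (\<tau> / 2 ^ j) (i + j)) (\<sigma> (Suc (t + j)))"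
      using Suc by auto
    then show ?case
      by cases (use no[of "Suc (t + j)"] in auto)
  qed
  obtain x y z where w: "w = (x, y, z)" by (cases w) auto
  have inv: "point (x, y, z)" "\<not> \<beta> * norm (res (x, y, z)) \<le> \<epsilon>" "\<tau> = 1 / 2 ^ i"
    using run_invariant[of t] unfolding assms w by auto
  have "res (x, y, z) \<noteq> 0" using inv(2) pos by auto
  from eventually_accepts[OF inv(1) this, of d] obtain N where
    N: "\<And>j w'. j \<ge> N \<Longrightarrow> w' \<in> outputs (trial_y A B b \<beta> lam (x, y, z) d (1 / 2 ^ j)) z
      \<Longrightarrow> accepts f g A B b \<beta> sg c (x, y, z) w'"
    unfolding eventually_sequentially by blast
  have "step (Trial k w d (\<tau> / 2 ^ N) (i + N)) (\<sigma> (Suc (t + N)))"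
    using run_step[of "t + N"] unfolding all by auto
  then show False
  proof cases
    case backtrack
    then show False using N[of "i + N"] unfolding w inv(3) by (auto simp: power_add)
  qed (use no[of "Suc (t + N)"] in auto)
qed

text \<open>Infinitely many backtrackings of iteration \<open>k\<close> would leave some of them after the start of
iteration \<open>k + 1\<close>, although iteration counters never decrease.\<close>

lemma finite_backtrackings: "finite (backtrackings \<sigma> k)"
proof (rule ccontr)
  assume inf: "infinite (backtrackings \<sigma> k)"
  then obtain t where "t \<in> backtrackings \<sigma> k" by (metis ex_in_conv finite.emptyI)
  then obtain w d \<tau> i where "\<sigma> t = Trial k w d \<tau> i" unfolding backtrackings_def by blast
  then obtain t' w' where t': "\<sigma> t' = Check (Suc k) w'" by (rule Trial_terminates)
  obtain t'' where "t'' \<ge> t'" "t'' \<in> backtrackings \<sigma> k"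
    using inf unfolding infinite_nat_iff_unbounded_le by blast
  then have "iteration (\<sigma> t') \<le> iteration (\<sigma> t'')" "iteration (\<sigma> t'') = k"
    using run_iteration_mono unfolding backtrackings_def by auto
  then show False unfolding t' by simp
qed

lemma iteration_bound: "real (iteration (\<sigma> t)) * decrement \<le> val w0 - sg * M"
proof -
  obtain w where "point w" "val w \<le> val w0 - real (iteration (\<sigma> t)) * decrement"
    using run_invariant[of t] by (cases "\<sigma> t") auto
  then show ?thesis using bound[of w] by linarith
qed

text \<open>A run that never stops would start every iteration, against the bound on the number of
iterations.\<close>

lemma run_stops: obtains T K w where "\<sigma> T = Stopped K w"
proof (rule ccontr)
  assume "\<not> thesis"
  then have no: "\<sigma> t \<noteq> Stopped k w" for t k w using that by metis
  have "\<exists>t w. \<sigma> t = Check k w" for k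
  proof (induction k)
    case 0
    then show ?case using run_start by blast
  next
    case (Suc k)
    then obtain t w where t: "\<sigma> t = Check k w" by blast
    from run_step[of t] have "step (Check k w) (\<sigma> (Suc t))" using no unfolding t by auto
    then obtain d where "\<sigma> (Suc t) = Trial k w d 1 0"
      by cases (use no[of "Suc t"] in auto)
    then show ?case using Trial_terminates by blast
  qed
  moreover obtain n :: nat where "(val w0 - sg * M) / decrement < n" using reals_Archimedean2 by blast
  ultimately obtain t w where "\<sigma> t = Check n w" by blast
  then have "real n * decrement \<le> val w0 - sg * M" using iteration_bound[of t] by simp
  then show False using \<open>(val w0 - sg * M) / decrement < n\<close> decrement_pos by (simp add: field_simps)
qed

theorem linesearch_terminates:
  assumes sg: "\<bar>sg\<bar> = 1"
  obtains T K x y z where "\<sigma> T = Stopped K (x, y, z)"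
    "real K \<le> \<beta> / (c * \<epsilon>\<^sup>2) * \<bar>lagrangian_value f g A B b \<beta> w0 - M\<bar>"
    "norm (A *v x + B *v z - b) \<le> \<epsilon> / \<beta>"
    "- (transpose A *v y) \<in> regular_subdiff f x"
    "set_dist (- (transpose B *v y)) (regular_subdiff g z) \<le> ereal (op_norm B * \<epsilon>)"
proof -
  obtain T K w where T: "\<sigma> T = Stopped K w" by (rule run_stops)
  obtain x y z where w: "w = (x, y, z)" by (cases w) auto
  have inv: "point (x, y, z)" "\<beta> * norm (res (x, y, z)) \<le> \<epsilon>"
    using run_invariant[of T] unfolding T w by auto
  have opt: "prox_opt f ((*v) A) \<beta> y x" "prox_opt g ((*v) B) \<beta> (y + \<beta> *\<^sub>R res (x, y, z)) z"
    using inv(1) unfolding admm_point_def by auto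
  have "real K * decrement \<le> sg * (lagrangian_value f g A B b \<beta> w0 - M)"
    using iteration_bound[of T] unfolding T by (simp add: algebra_simps)
  also have "\<dots> \<le> \<bar>lagrangian_value f g A B b \<beta> w0 - M\<bar>"
    using sg abs_ge_self[of "sg * (lagrangian_value f g A B b \<beta> w0 - M)"] by (simp add: abs_mult)
  finally have K: "real K \<le> \<beta> / (c * \<epsilon>\<^sup>2) * \<bar>lagrangian_value f g A B b \<beta> w0 - M\<bar>"
    unfolding decrement_def using pos by (simp add: field_simps)
  have feas: "norm (A *v x + B *v z - b) \<le> \<epsilon> / \<beta>"
    using inv(2) pos unfolding residual_def by (simp add: field_simps)
  have "set_dist (- (transpose B *v y)) (regular_subdiff g z)
      \<le> ereal (op_norm B * norm (\<beta> *\<^sub>R res (x, y, z)))"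
    by (rule prox_opt_set_dist[OF opt(2)])
  also have "\<dots> \<le> ereal (op_norm B * \<epsilon>)"
    using inv(2) pos by (simp add: op_norm_def mult_left_mono onorm_pos_le matrix_vector_mul_bounded_linear)
  finally have "set_dist (- (transpose B *v y)) (regular_subdiff g z) \<le> ereal (op_norm B * \<epsilon>)" .
  with T K feas prox_opt_regular_subdiff[OF opt(1)] show thesis
    unfolding w by (intro that)
qed

end

end

section \<open>The two cases\<close>

lemma linesearch_C_const:
  fixes f :: "real^'m \<Rightarrow> ereal" and A :: "real^'m^'p"
  assumes "0 < lam" "0 \<le> \<alpha>" "0 < c" "c < C_const f A \<alpha> lam"
  defines "m \<equiv> (if convex_fun (epicomp A f) then max (\<alpha> - lam / 2) 0 else 1)"
  shows "c < lam / (1 + \<alpha>)\<^sup>2 * ((2 - lam) / 2 - \<alpha> * m)" and "0 \<le> (2 - lam) / 2 - \<alpha> * m"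
proof -
  show c: "c < lam / (1 + \<alpha>)\<^sup>2 * ((2 - lam) / 2 - \<alpha> * m)"
    using assms(4) unfolding C_const_def m_def .
  then have "0 < lam / (1 + \<alpha>)\<^sup>2 * ((2 - lam) / 2 - \<alpha> * m)" using assms(3) by linarith
  moreover have "0 < lam / (1 + \<alpha>)\<^sup>2" using assms(1,2) by simp
  ultimately show "0 \<le> (2 - lam) / 2 - \<alpha> * m" by (metis less_imp_le zero_less_mult_pos)
qed

lemma smooth_linesearch:
  fixes f :: "real^'m \<Rightarrow> ereal" and g :: "real^'n \<Rightarrow> ereal" and A :: "real^'m^'p"
    and B :: "real^'n^'p"
  assumes "0 < \<epsilon>" "0 < lam" "lam < 2" and sm: "smooth_case f g A B b L"
    and \<beta>: "if convex_fun f then \<beta> > L else \<beta> > 2 * L / (2 - lam)"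
    and c: "0 < c" "c < C_const f A (L / \<beta>) lam"
  obtains \<alpha> \<kappa> M where "min_Phi f g A B b = ereal M"
    "linesearch f g A B b \<beta> 1 c lam \<epsilon> \<alpha> \<kappa> M"
proof -
  obtain G where grad: "\<And>s. GDERIV (\<lambda>s. real_of_ereal (epicomp A f s)) s :> G s"
    and lip: "L-lipschitz_on UNIV G"
    using sm unfolding smooth_case_def by metis
  have fin: "\<bar>epicomp A f s\<bar> \<noteq> \<infinity>" and f: "\<bar>f x\<bar> \<noteq> \<infinity>" and g: "g z \<noteq> -\<infinity>" for s x z
    using sm unfolding smooth_case_def by metis+
  obtain w where w: "Phi f g A B b w < \<infinity>" "\<And>w'. Phi f g A B b w \<le> Phi f g A B b w'"
    using sm unfolding smooth_case_def argmin_def by auto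
  have "min_Phi f g A B b = Phi f g A B b w"
    unfolding min_Phi_def by (rule antisym) (auto intro: INF_lower INF_greatest w)
  moreover have "Phi f g A B b w \<noteq> -\<infinity>"
    using f[of "fst w"] g[of "snd w"] unfolding Phi_def
    by (cases w; cases "f (fst w)"; cases "g (snd w)") auto
  ultimately obtain M where M: "min_Phi f g A B b = ereal M"
    using w(1) by (cases "Phi f g A B b w") auto
  have L: "0 \<le> L" using lip by (rule lipschitz_on_nonneg)
  have "L \<le> 2 * L / (2 - lam)" using L assms(2,3) by (simp add: field_simps)
  then have L\<beta>: "L < \<beta>" using \<beta> by (cases "convex_fun f") auto
  then have \<beta>0: "0 < \<beta>" using L by simp
  define m where "m = (if convex_fun (epicomp A f) then max (L / \<beta> - lam / 2) 0 else 1)"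
  have "0 \<le> L / \<beta>" using L \<beta>0 by simp
  note C = linesearch_C_const[OF assms(2) this c, folded m_def]
  have "linesearch f g A B b \<beta> 1 c lam \<epsilon> (L / \<beta>) ((2 - lam) / 2 - L / \<beta> * m) M"
  proof
    show "f x \<noteq> -\<infinity>" for x using f[of x] by auto
    show "1 * M \<le> 1 * lagrangian_value f g A B b \<beta> w" if "admm_point f g A B b \<beta> w" for w
      using smooth_min_Phi_le[OF L\<beta> fin grad lip that] unfolding M by simp
    show "progress \<beta> lam (L / \<beta>) ((2 - lam) / 2 - L / \<beta> * m) (residual A B b w) (dr_shift A B b \<beta> lam w w')
      \<le> 1 * lagrangian_value f g A B b \<beta> w - 1 * lagrangian_value f g A B b \<beta> w'"
      if "admm_point f g A B b \<beta> w" "admm_point f g A B b \<beta> w'" for w w'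
      using smooth_progress[OF \<beta>0 assms(2) L\<beta> C(2) fin grad lip m_def that] by simp
  qed (use assms \<beta>0 g C(1) in auto)
  with M show thesis by (rule that)
qed

text \<open>The relative interior condition enters through feasibility, which keeps the optimal value below
\<open>\<infinity>\<close>; the point \<open>w0\<close> keeps it above \<open>-\<infinity>\<close> by weak duality.\<close>

lemma strongly_convex_linesearch:
  fixes f :: "real^'m \<Rightarrow> ereal" and g :: "real^'n \<Rightarrow> ereal" and A :: "real^'m^'p"
    and B :: "real^'n^'p"
  assumes "0 < \<epsilon>" "0 < lam" and sc: "strongly_convex_case f g A B b \<mu>"
    and \<beta>: "0 < \<beta>" "\<beta> * (op_norm A)\<^sup>2 < \<mu>"
    and c: "0 < c" "c < C_const f A (\<beta> * (op_norm A)\<^sup>2 / \<mu>) lam"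
    and w0: "w0 \<in> ADMM f g A B b \<beta> y' z'"
  obtains \<alpha> \<kappa> M where "min_Phi f g A B b = ereal M"
    "linesearch f g A B b \<beta> (-1) c lam \<epsilon> \<alpha> \<kappa> M"
proof -
  have conv: "convex_fun (\<lambda>x. f x - ereal (\<mu> / 2 * (norm x)\<^sup>2))" "convex_fun (epicomp B g)"
    and \<mu>: "0 < \<mu>" and f: "f x \<noteq> -\<infinity>" and epi: "epicomp B g s \<noteq> -\<infinity>" for x s
    using sc unfolding strongly_convex_case_def strongly_convex_fun_def proper_fun_def by auto
  have g: "g z \<noteq> -\<infinity>" for z
  proof -
    have "epicomp B g (B *v z) \<le> g z" unfolding epicomp_def by (rule INF_lower) simp
    then show ?thesis using epi[of "B *v z"] by auto
  qed
  note lower = strongly_convex_le_min_Phi[OF \<beta> conv]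
  have "b \<in> {A *v x + B *v z | x z. x \<in> eff_dom f \<and> z \<in> eff_dom g}"
    using sc rel_interior_subset unfolding strongly_convex_case_def by blast
  then obtain x z where xz: "A *v x + B *v z = b" "f x < \<infinity>" "g z < \<infinity>"
    unfolding eff_dom_def by auto
  have "min_Phi f g A B b \<le> Phi f g A B b (x, z)" unfolding min_Phi_def by (rule INF_lower) simp
  also have "\<dots> < \<infinity>" using xz unfolding Phi_def by simp
  finally obtain M where M: "min_Phi f g A B b = ereal M"
    using lower[OF ADMM_admm_point[OF w0 f g]] by (cases "min_Phi f g A B b") auto
  define \<alpha> where "\<alpha> = \<beta> * (op_norm A)\<^sup>2 / \<mu>"
  have \<alpha>: "0 \<le> \<alpha>" "\<alpha> < 1" using \<beta> \<mu> unfolding \<alpha>_def by auto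
  define m where "m = (if convex_fun (epicomp A f) then max (\<alpha> - lam / 2) 0 else 1)"
  \<comment> \<open>As \<open>\<alpha> < 1\<close>, the value \<open>1\<close> also exceeds the convex constant.\<close>
  have m: "max (\<alpha> - lam / 2) 0 \<le> m" using \<alpha> assms(2) unfolding m_def by auto
  note C = linesearch_C_const[OF assms(2) \<alpha>(1) c(1) c(2)[folded \<alpha>_def], folded m_def]
  have "linesearch f g A B b \<beta> (-1) c lam \<epsilon> \<alpha> ((2 - lam) / 2 - \<alpha> * m) M"
  proof
    show "-1 * M \<le> -1 * lagrangian_value f g A B b \<beta> w" if "admm_point f g A B b \<beta> w" for w
      using lower[OF that] unfolding M by simp
    show "progress \<beta> lam \<alpha> ((2 - lam) / 2 - \<alpha> * m) (residual A B b w) (dr_shift A B b \<beta> lam w w')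
      \<le> -1 * lagrangian_value f g A B b \<beta> w - -1 * lagrangian_value f g A B b \<beta> w'"
      if "admm_point f g A B b \<beta> w" "admm_point f g A B b \<beta> w'" for w w'
      using strongly_convex_progress[OF \<beta>(1) assms(2) \<beta>(2) conv m[unfolded \<alpha>_def] C(2)[unfolded \<alpha>_def] that]
      unfolding \<alpha>_def by simp
  qed (use assms f g C(1) in auto)
  with M show thesis by (rule that)
qed

theorem theorem4p2:
  fixes f :: "real^'m \<Rightarrow> ereal" and g :: "real^'n \<Rightarrow> ereal"
    and A :: "real^'m^'p" and B :: "real^'n^'p" and b :: "real^'p"
    and L \<mu> \<beta> sg c lam \<epsilon> :: real and imax :: enat
    and w_in :: "(real^'m) \<times> (real^'p) \<times> (real^'n)"
    and x0 :: "real^'m" and y0 :: "real^'p" and z0 :: "real^'n"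
    and \<sigma> :: "nat \<Rightarrow> ('m, 'p, 'n) ls_state"
  assumes "\<epsilon> > 0" and "0 < lam" and "lam < 2"
    and "(smooth_case f g A B b L \<and> sg = 1 \<and>
            (if convex_fun f then \<beta> > L else \<beta> > 2 * L / (2 - lam)) \<and>
            0 < c \<and> c < C_const f A (L / \<beta>) lam)
       \<or> (strongly_convex_case f g A B b \<mu> \<and> sg = -1 \<and>
            0 < \<beta> \<and> \<beta> * (op_norm A)\<^sup>2 < \<mu> \<and>
            0 < c \<and> c < C_const f A (\<beta> * (op_norm A)\<^sup>2 / \<mu>) lam)"
    and "ls_run f g A B b \<beta> sg c lam \<epsilon> imax w_in (x0, y0, z0) \<sigma>"
  shows "(\<forall>k. finite (backtrackings \<sigma> k)) \<and>
    (\<exists>T K x y z. \<sigma> T = Stopped K (x, y, z) \<and>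
       ereal (real K) \<le> ereal (\<beta> / (c * \<epsilon>\<^sup>2)) *
         \<bar>aug_lagrangian f g A B b \<beta> x0 z0 y0 - min_Phi f g A B b\<bar> \<and>
       norm (A *v x + B *v z - b) \<le> \<epsilon> / \<beta> \<and>
       - (transpose A *v y) \<in> regular_subdiff f x \<and>
       set_dist (- (transpose B *v y)) (regular_subdiff g z) \<le> ereal (op_norm B * \<epsilon>))"
proof -
  have w0: "(x0, y0, z0) \<in> ADMM f g A B b \<beta> (nominal_y A B b \<beta> lam w_in) (snd (snd w_in))"
    using conjunct1[OF assms(5)[unfolded ls_run_def]] .
  obtain \<alpha> \<kappa> M where M: "min_Phi f g A B b = ereal M"
    and ls: "linesearch f g A B b \<beta> sg c lam \<epsilon> \<alpha> \<kappa> M" and sg: "\<bar>sg\<bar> = 1"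
    using assms(4)
  proof (elim disjE conjE)
    assume "smooth_case f g A B b L" "sg = 1" "0 < c" "c < C_const f A (L / \<beta>) lam"
      "if convex_fun f then \<beta> > L else \<beta> > 2 * L / (2 - lam)"
    then show thesis using smooth_linesearch[of \<epsilon> lam f g A B b L \<beta> c] assms(1-3) that by auto
  next
    assume "strongly_convex_case f g A B b \<mu>" "sg = -1" "0 < \<beta>" "\<beta> * (op_norm A)\<^sup>2 < \<mu>"
      "0 < c" "c < C_const f A (\<beta> * (op_norm A)\<^sup>2 / \<mu>) lam"
    then show thesis using strongly_convex_linesearch[OF assms(1,2) _ _ _ _ _ w0, of \<mu> c] that by auto
  qed
  interpret linesearch f g A B b \<beta> sg c lam \<epsilon> \<alpha> \<kappa> M imax by (rule ls)
  obtain T K x y z where T: "\<sigma> T = Stopped K (x, y, z)"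
    and K: "real K \<le> \<beta> / (c * \<epsilon>\<^sup>2) * \<bar>lagrangian_value f g A B b \<beta> (x0, y0, z0) - M\<bar>"
    and kkt: "norm (A *v x + B *v z - b) \<le> \<epsilon> / \<beta>"
    "- (transpose A *v y) \<in> regular_subdiff f x"
    "set_dist (- (transpose B *v y)) (regular_subdiff g z) \<le> ereal (op_norm B * \<epsilon>)"
    using linesearch_terminates[OF assms(5) sg] by blast
  have "aug_lagrangian f g A B b \<beta> x0 z0 y0 = ereal (lagrangian_value f g A B b \<beta> (x0, y0, z0))"
    using admm_point_values[OF output_point[OF w0]] by metis
  then have "ereal (real K) \<le> ereal (\<beta> / (c * \<epsilon>\<^sup>2)) *
      \<bar>aug_lagrangian f g A B b \<beta> x0 z0 y0 - min_Phi f g A B b\<bar>"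
    using K M by simp
  then show ?thesis using finite_backtrackings[OF assms(5)] T kkt by blast
qed

end
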